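(* Let $T$ be a bounded operator on $\mathcal{H}$. For $0<t<1$, $\lim_{n\to\infty}\|\Delta_t^{(n)}(T)\|=r(T)$.
   Context: $\mathcal{H}$ is a complex infinite-dimensional Hilbert space. For a bounded operator $T$ on $\mathcal{H}$ with canonical polar decomposition $T=V|T|$ ($|T|=\sqrt{T^*T}$, $V$ a partial isometry with $\ker V=\ker T$) and $0<t<1$, the generalized Aluthge transform is $\Delta_t(T):=|T|^tV|T|^{1-t}$. $\Delta_t^{(n)}$ denotes the $n$-th iterate of $\Delta_t$, and $r(T)$ is the spectral radius of $T$. *)

theory Defs
  imports "HOL-Analysis.Analysis" "HOL-Computational_Algebra.Polynomial"
begin

text \<open>
  Complex inner product spaces, with the inner product linear in the first argument.
  The underlying real inner product of the library is its real part, so that the norm is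
  \<open>sqrt (Re (cinner x x))\<close>, i.e. \<open>sqrt (cinner x x)\<close>; positive definiteness is inherited
  from \<open>real_inner\<close>.
\<close>

class complex_inner = real_inner +
  fixes scaleC :: "complex \<Rightarrow> 'a \<Rightarrow> 'a" (infixr "*\<^sub>C" 75)
    and cinner :: "'a \<Rightarrow> 'a \<Rightarrow> complex"
  assumes scaleC_add_right: "a *\<^sub>C (x + y) = a *\<^sub>C x + a *\<^sub>C y"
    and scaleC_add_left: "(a + b) *\<^sub>C x = a *\<^sub>C x + b *\<^sub>C x"
    and scaleC_scaleC: "a *\<^sub>C (b *\<^sub>C x) = (a * b) *\<^sub>C x"
    and scaleC_of_real: "complex_of_real r *\<^sub>C x = r *\<^sub>R x"
    and cinner_commute: "cinner x y = cnj (cinner y x)"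
    and cinner_add_left: "cinner (x + y) z = cinner x z + cinner y z"
    and cinner_scaleC_left: "cinner (a *\<^sub>C x) y = a * cinner x y"
    and Re_cinner: "Re (cinner x y) = x \<bullet> y"

class chilbert_space = complex_inner + banach

global_interpretation complex_vector: vector_space "scaleC :: complex \<Rightarrow> 'a \<Rightarrow> 'a::complex_inner"
proof
  show "1 *\<^sub>C x = x" for x :: 'a
    using scaleC_of_real[of 1 x] by simp
qed (simp_all add: scaleC_add_right scaleC_add_left scaleC_scaleC)

definition infinite_dimensional :: "'a::complex_inner itself \<Rightarrow> bool" where
  "infinite_dimensional _ \<longleftrightarrow> (\<nexists>B :: 'a set. finite B \<and> complex_vector.span B = UNIV)"

text \<open>
  The library type of bounded operators only records real linearity; a bounded operator on a
  complex Hilbert space is an element of it satisfying the following predicate. In the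
  definitions of the adjoint, the spectrum and the functional calculus below the operators
  bound by a quantifier or by \<open>THE\<close> are automatically complex linear when the given one is.
\<close>

definition clinear_op :: "('a::complex_inner \<Rightarrow>\<^sub>L 'a) \<Rightarrow> bool" where
  "clinear_op T \<longleftrightarrow> (\<forall>a x. blinfun_apply T (a *\<^sub>C x) = a *\<^sub>C blinfun_apply T x)"

definition op_adjoint :: "('a::chilbert_space \<Rightarrow>\<^sub>L 'a) \<Rightarrow> ('a \<Rightarrow>\<^sub>L 'a)" where
  "op_adjoint T =
     (THE S. \<forall>x y. cinner (blinfun_apply T x) y = cinner x (blinfun_apply S y))"

definition op_spectrum :: "('a::chilbert_space \<Rightarrow>\<^sub>L 'a) \<Rightarrow> complex set" where
  "op_spectrum T =
     {z. \<not> (\<exists>S :: 'a \<Rightarrow>\<^sub>L 'a. \<forall>x.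
              blinfun_apply S (blinfun_apply T x - z *\<^sub>C x) = x \<and>
              blinfun_apply T (blinfun_apply S x) - z *\<^sub>C blinfun_apply S x = x)}"

definition op_spectral_radius :: "('a::chilbert_space \<Rightarrow>\<^sub>L 'a) \<Rightarrow> real" where
  "op_spectral_radius T = (SUP z\<in>op_spectrum T. cmod z)"

definition op_poly :: "real poly \<Rightarrow> ('a::chilbert_space \<Rightarrow>\<^sub>L 'a) \<Rightarrow> ('a \<Rightarrow>\<^sub>L 'a)" where
  "op_poly p A = (\<Sum>i\<le>degree p. coeff p i *\<^sub>R (((o\<^sub>L) A) ^^ i) id_blinfun)"

text \<open>
  Continuous functional calculus of a self-adjoint operator \<open>A\<close>: \<open>f(A)\<close> is the operator norm
  limit of \<open>p\<^sub>n(A)\<close> for polynomials \<open>p\<^sub>n\<close> converging to \<open>f\<close> uniformly on the (real) spectrum.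
  The limit exists, and is independent of the polynomials, when \<open>f\<close> is continuous there.
\<close>

definition op_fun :: "(real \<Rightarrow> real) \<Rightarrow> ('a::chilbert_space \<Rightarrow>\<^sub>L 'a) \<Rightarrow> ('a \<Rightarrow>\<^sub>L 'a)" where
  "op_fun f A =
     (THE B. \<exists>p :: nat \<Rightarrow> real poly.
        uniform_limit {x. complex_of_real x \<in> op_spectrum A} (\<lambda>n. poly (p n)) f sequentially \<and>
        (\<lambda>n. op_poly (p n) A) \<longlonglongrightarrow> B)"

definition op_abs :: "('a::chilbert_space \<Rightarrow>\<^sub>L 'a) \<Rightarrow> ('a \<Rightarrow>\<^sub>L 'a)" where
  "op_abs T = op_fun sqrt (op_adjoint T o\<^sub>L T)"

text \<open>For \<open>s > 0\<close>, \<open>x powr s\<close> is continuous on the nonnegative reals, with value 0 at 0.\<close>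

definition op_powr :: "('a::chilbert_space \<Rightarrow>\<^sub>L 'a) \<Rightarrow> real \<Rightarrow> ('a \<Rightarrow>\<^sub>L 'a)" where
  "op_powr A s = op_fun (\<lambda>x. x powr s) A"

definition op_ker :: "('a::chilbert_space \<Rightarrow>\<^sub>L 'a) \<Rightarrow> 'a set" where
  "op_ker T = {x. blinfun_apply T x = 0}"

definition partial_isometry :: "('a::chilbert_space \<Rightarrow>\<^sub>L 'a) \<Rightarrow> bool" where
  "partial_isometry V \<longleftrightarrow> clinear_op V \<and>
     (\<forall>x. (\<forall>y\<in>op_ker V. cinner x y = 0) \<longrightarrow> norm (blinfun_apply V x) = norm x)"

definition polar_isometry :: "('a::chilbert_space \<Rightarrow>\<^sub>L 'a) \<Rightarrow> ('a \<Rightarrow>\<^sub>L 'a)" where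
  "polar_isometry T =
     (THE V. partial_isometry V \<and> op_ker V = op_ker T \<and> T = V o\<^sub>L op_abs T)"

definition aluthge :: "real \<Rightarrow> ('a::chilbert_space \<Rightarrow>\<^sub>L 'a) \<Rightarrow> ('a \<Rightarrow>\<^sub>L 'a)" where
  "aluthge t T = op_powr (op_abs T) t o\<^sub>L polar_isometry T o\<^sub>L op_powr (op_abs T) (1 - t)"

end

theory Submission
  imports Defs "HOL-Complex_Analysis.Complex_Analysis"
    "HOL-Computational_Algebra.Fundamental_Theorem_Algebra"
begin

text \<open>
  With \<open>T = V|T|\<close> one has \<open>\<Delta>(T)\<^sup>k\<^sup>+\<^sup>1 = |T|\<^sup>t X |T|\<^sup>1\<^sup>-\<^sup>t\<close> for \<open>X = T\<^sup>k V\<close>. The norm of \<open>|T|\<^sup>a X |T|\<^sup>b\<close>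
  is logarithmically convex in \<open>(a, b)\<close>, and its values at \<open>(0, 0)\<close>, \<open>(0, 1)\<close>, \<open>(1, 0)\<close> and \<open>(1, 1)\<close>
  are at most the norms of \<open>T\<^sup>k\<close>, \<open>T\<^sup>k\<^sup>+\<^sup>1\<close>, \<open>T\<^sup>k\<^sup>+\<^sup>1\<close> and \<open>T\<^sup>k\<^sup>+\<^sup>2\<close>. Hence the norms of the \<open>k\<close>-th powers of
  the iterates decrease to limits \<open>L\<^sub>k\<close>, and these satisfy \<open>L\<^sub>k\<^sub>+\<^sub>1\<^sup>2 \<le> L\<^sub>k L\<^sub>k\<^sub>+\<^sub>2\<close>. As \<open>L\<^sub>0 = 1\<close>, this gives
  \<open>L\<^sub>1\<^sup>k \<le> L\<^sub>k \<le> \<parallel>T\<^sup>k\<parallel>\<close>, so that the spectral radius is at least \<open>L\<^sub>1\<close>. Conversely \<open>\<Delta>(T)\<close> and \<open>T\<close> have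
  the same nonzero spectrum, which is bounded by the norm of every iterate.
\<close>

section \<open>Complex Hilbert spaces\<close>

text \<open>The pair \<open>(t, 1 - t)\<close> lies on the segment from \<open>(0, 1)\<close> to
  \<open>(1, 0)\<close>. Convexity along it gives monotonicity only; the inequality between three
  consecutive powers arises because the centre \<open>(1/2, 1/2)\<close> is also the midpoint of
  \<open>(0, 0)\<close> and \<open>(1, 1)\<close>. With u = min t (1 - t), the limit of this
  estimate reads L(k+1) \<le> L(k+1)^(1-2u) (L(k) L(k+2))^u, and u > 0 allows the power of L(k+1) to
  be cancelled. The convexity itself needs no complex analysis: norm (UW) \<le> norm (WU) for
  self-adjoint UW gives the midpoint case, and boundedness stands in for continuity in the
  exponents. Complex analysis enters in the lower bound for the spectral radius, through Cauchy
  estimates for the resolvent. Since \<open>op_adjoint\<close>, \<open>op_fun\<close> and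
  \<open>polar_isometry\<close> are given by \<open>THE\<close>, each requires existence and
  uniqueness. For \<open>op_fun\<close> both rest on bounding the norm of p(A) by values of |p| on
  the approximate spectrum, which is reached by factoring real polynomials instead of by a spectral
  theorem.\<close>

lemma Im_cinner: "Im (cinner x y) = - ((\<i> *\<^sub>C x) \<bullet> y)"
  by (simp flip: Re_cinner add: cinner_scaleC_left)

lemma cinner_scaleC_right: "cinner x (a *\<^sub>C y) = cnj a * cinner x y"
  by (metis cinner_commute cinner_scaleC_left complex_cnj_mult)

lemma inner_scaleC_left: "(a *\<^sub>C x) \<bullet> y = x \<bullet> (cnj a *\<^sub>C y)"
  by (simp flip: Re_cinner add: cinner_scaleC_left cinner_scaleC_right)

lemma norm_scaleC: "norm (a *\<^sub>C x) = cmod a * norm x"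
proof -
  have "(norm (a *\<^sub>C x))\<^sup>2 = (a *\<^sub>C x) \<bullet> (a *\<^sub>C x)"
    by (simp add: power2_norm_eq_inner)
  also have "\<dots> = x \<bullet> (complex_of_real ((cmod a)\<^sup>2) *\<^sub>C x)"
    by (simp add: inner_scaleC_left scaleC_scaleC complex_norm_square mult.commute flip: of_real_power)
  also have "\<dots> = (cmod a * norm x)\<^sup>2"
    by (simp add: scaleC_of_real power2_norm_eq_inner power_mult_distrib del: of_real_power)
  finally show ?thesis by (simp add: power2_eq_iff_nonneg)
qed

lemma bounded_linear_scaleC: "bounded_linear (\<lambda>x. a *\<^sub>C x)"
proof (rule bounded_linear_intro[where K = "cmod a"])
  show "a *\<^sub>C (r *\<^sub>R x) = r *\<^sub>R (a *\<^sub>C x)" for r x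
    by (simp add: scaleC_scaleC mult.commute flip: scaleC_of_real)
qed (simp_all add: scaleC_add_right norm_scaleC mult.commute)

text \<open>\<open>Im_cinner\<close> writes the imaginary part as a real inner product with
  \<open>\<i> *\<^sub>C x\<close>, so complex linearity carries the real adjoint relation over to
  it. Riesz representation and adjoints can therefore be treated over the reals.\<close>

lemma cinner_eq_if_inner_eq:
  assumes "\<And>x y. f x \<bullet> y = x \<bullet> g y" and "\<And>a x. f (a *\<^sub>C x) = a *\<^sub>C f x"
  shows "cinner (f x) y = cinner x (g y)"
  by (rule complex_eqI) (simp_all add: Re_cinner Im_cinner assms(1) flip: assms(2))

lemma clinear_op_compose: "clinear_op S \<Longrightarrow> clinear_op T \<Longrightarrow> clinear_op (S o\<^sub>L T)"
  by (simp add: clinear_op_def)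

lemma clinear_op_tendsto:
  assumes "\<And>n. clinear_op (S n)" and lim: "\<And>x. (\<lambda>n. blinfun_apply (S n) x) \<longlonglongrightarrow> blinfun_apply T x"
  shows "clinear_op T"
  unfolding clinear_op_def
proof (intro allI)
  fix a x
  have "(\<lambda>n. a *\<^sub>C blinfun_apply (S n) x) \<longlonglongrightarrow> a *\<^sub>C blinfun_apply T x"
    by (intro bounded_linear.tendsto[OF bounded_linear_scaleC] lim)
  moreover have "blinfun_apply (S n) (a *\<^sub>C x) = a *\<^sub>C blinfun_apply (S n) x" for n
    using assms(1) by (simp add: clinear_op_def)
  ultimately show "blinfun_apply T (a *\<^sub>C x) = a *\<^sub>C blinfun_apply T x"
    using LIMSEQ_unique[OF lim[of "a *\<^sub>C x"]] by simp
qed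

section \<open>Riesz representation and adjoints\<close>

text \<open>A nonzero linear term dominates the quadratic one near 0. This is the first-order
  condition at the minimizer in the Riesz argument.\<close>

lemma quadratic_nonneg_imp_zero:
  fixes b c :: real
  assumes "\<And>s. 0 \<le> s * b + s\<^sup>2 * c" shows "b = 0"
proof (rule ccontr)
  assume "b \<noteq> 0"
  define d where "d = \<bar>c\<bar> + 1"
  have "d > 0" "c < d" unfolding d_def by auto
  have "- b / d * b + (- b / d)\<^sup>2 * c = b\<^sup>2 / d * (c / d - 1)"
    using \<open>d > 0\<close> by (simp add: field_simps power2_eq_square)
  moreover have "\<dots> < 0"
    using \<open>b \<noteq> 0\<close> \<open>d > 0\<close> \<open>c < d\<close> by (intro mult_pos_neg) auto
  ultimately show False using assms[of "- b / d"] by simp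
qed

text \<open>The representing vector minimizes \<open>\<parallel>x\<parallel>\<^sup>2 / 2 - f x\<close>; a minimizing sequence is Cauchy by the
  parallelogram law.\<close>

lemma riesz_representation:
  fixes f :: "'a::{real_inner,banach} \<Rightarrow> real"
  assumes "bounded_linear f"
  obtains y where "\<And>x. f x = x \<bullet> y"
proof -
  interpret bounded_linear f by fact
  define Q where "Q x = (norm x)\<^sup>2 / 2 - f x" for x
  obtain K where K: "\<And>x. norm (f x) \<le> norm x * K" using bounded by blast
  have "Q x \<ge> - K\<^sup>2 / 2" for x
  proof -
    have "f x \<le> norm x * K" using K[of x] by simp
    then show ?thesis unfolding Q_def using zero_le_power2[of "norm x - K"]
      by (simp add: power2_diff)
  qed
  then have bdd: "bdd_below (range Q)" by (intro bdd_belowI2)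
  define m where "m = Inf (range Q)"
  have m: "m \<le> Q x" for x unfolding m_def using bdd by (simp add: cInf_lower)
  have "\<exists>x. Q x < m + inverse (real (Suc n))" for n
    using cInf_lessD[of "range Q" "m + inverse (real (Suc n))"] unfolding m_def by auto
  then obtain X where X: "\<And>n. Q (X n) < m + inverse (real (Suc n))" by metis
  have par: "(norm (x - y))\<^sup>2 \<le> 4 * (Q x + Q y - 2 * m)" for x y
  proof -
    have "m \<le> Q ((1/2) *\<^sub>R (x + y))" by (rule m)
    also have "\<dots> = (norm (x + y))\<^sup>2 / 8 - (f x + f y) / 2"
      unfolding Q_def by (simp add: scale add power_mult_distrib power_divide)
    finally show ?thesis unfolding Q_def power2_norm_eq_inner
      by (simp add: inner_add_left inner_add_right inner_diff_left inner_diff_right inner_commute field_simps)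
  qed
  have "Cauchy X"
  proof (rule CauchyI)
    fix e :: real assume "e > 0"
    then obtain N where N: "inverse (real (Suc N)) < e\<^sup>2 / 8" using reals_Archimedean[of "e\<^sup>2/8"] by auto
    have "norm (X i - X j) < e" if "i \<ge> N" "j \<ge> N" for i j
    proof -
      have *: "Q (X k) < m + e\<^sup>2 / 8" if "k \<ge> N" for k
      proof -
        have "inverse (real (Suc k)) \<le> inverse (real (Suc N))" using that by (simp add: field_simps)
        then show ?thesis using X[of k] N by linarith
      qed
      have "(norm (X i - X j))\<^sup>2 < e\<^sup>2"
        using par[of "X i" "X j"] *[OF that(1)] *[OF that(2)] by (simp add: algebra_simps)
      then show ?thesis using \<open>e > 0\<close> by (meson less_imp_le power_less_imp_less_base)
    qed
    then show "\<exists>M. \<forall>i\<ge>M. \<forall>j\<ge>M. norm (X i - X j) < e" by blast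
  qed
  then obtain y where y: "X \<longlonglongrightarrow> y" using Cauchy_convergent_iff convergent_def by blast
  have "(\<lambda>n. Q (X n)) \<longlonglongrightarrow> Q y" unfolding Q_def by (intro tendsto_intros y tendsto) simp
  moreover have "(\<lambda>n. Q (X n)) \<longlonglongrightarrow> m"
  proof (rule tendsto_sandwich[OF _ _ tendsto_const[of m]])
    show "(\<lambda>n. m + inverse (real (Suc n))) \<longlonglongrightarrow> m"
      using tendsto_add[OF tendsto_const[of m] LIMSEQ_inverse_real_of_nat] by simp
  qed (use m X less_imp_le in \<open>auto intro!: always_eventually\<close>)
  ultimately have Qy: "Q y = m" by (rule LIMSEQ_unique)
  have "f x = x \<bullet> y" for x
  proof -
    \<comment> \<open>Minimality of \<open>Q\<close> at \<open>y\<close> along the line through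
      \<open>y\<close> in direction \<open>x\<close>.\<close>
    have "0 \<le> s * (x \<bullet> y - f x) + s\<^sup>2 * ((norm x)\<^sup>2 / 2)" for s
    proof -
      have "Q (y + s *\<^sub>R x) = Q y + s * (x \<bullet> y - f x) + s\<^sup>2 * ((norm x)\<^sup>2 / 2)"
        unfolding Q_def power2_norm_eq_inner
        by (simp add: scale add inner_add_left inner_add_right inner_commute algebra_simps power2_eq_square)
      then show ?thesis using m[of "y + s *\<^sub>R x"] Qy by simp
    qed
    then show ?thesis using quadratic_nonneg_imp_zero by fastforce
  qed
  then show thesis by (rule that)
qed

text \<open>Stated without complex structure, so that it also supplies an adjoint for the arbitrary
  real-linear \<open>X\<close> of the interpolation argument.\<close>

lemma adjoint_exists:
  fixes T :: "'a::{real_inner,banach} \<Rightarrow>\<^sub>L 'a"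
  obtains S :: "'a \<Rightarrow>\<^sub>L 'a" where "\<And>x y. blinfun_apply T x \<bullet> y = x \<bullet> blinfun_apply S y"
proof -
  have "\<exists>z. \<forall>x. T x \<bullet> y = x \<bullet> z" for y
  proof -
    have "bounded_linear (\<lambda>x. T x \<bullet> y)"
      by (intro bounded_linear_inner_left_comp blinfun.bounded_linear_right)
    from riesz_representation[OF this] show ?thesis by blast
  qed
  then obtain S where S: "\<And>x y. T x \<bullet> y = x \<bullet> S y" by metis
  have "bounded_linear S"
  proof (rule bounded_linear_intro[where K = "norm T"])
    show "S (x + y) = S x + S y" for x y
      by (rule vector_eq_ldot[THEN iffD1]) (simp add: inner_add_right flip: S)
    show "S (r *\<^sub>R x) = r *\<^sub>R S x" for r x
      by (rule vector_eq_ldot[THEN iffD1]) (simp flip: S)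
    show "norm (S y) \<le> norm y * norm T" for y
    proof (cases "S y = 0")
      case False
      have "norm (S y) * norm (S y) = T (S y) \<bullet> y"
        by (simp add: S power2_norm_eq_inner flip: power2_eq_square)
      also have "\<dots> \<le> norm (T (S y)) * norm y" by (rule norm_cauchy_schwarz)
      also have "\<dots> \<le> (norm T * norm (S y)) * norm y" by (intro mult_right_mono norm_blinfun) auto
      finally show ?thesis using False by (simp add: mult.commute mult.left_commute)
    qed simp
  qed
  then show thesis using that[of "Blinfun S"] S by (simp add: bounded_linear_Blinfun_apply)
qed

text \<open>Resolves the \<open>THE\<close> in \<open>op_adjoint\<close>: the real adjoint is a
  complex one by \<open>cinner_eq_if_inner_eq\<close>, and real parts alone determine it.\<close>

lemma inner_adjoint:
  fixes T :: "'a::chilbert_space \<Rightarrow>\<^sub>L 'a"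
  assumes "clinear_op T"
  shows "blinfun_apply T x \<bullet> y = x \<bullet> blinfun_apply (op_adjoint T) y"
proof -
  obtain S where S: "\<And>x y. T x \<bullet> y = x \<bullet> blinfun_apply S y" using adjoint_exists[of T] by blast
  have cS: "cinner (T x) y = cinner x (S y)" for x y
    using S assms cinner_eq_if_inner_eq unfolding clinear_op_def by metis
  have "op_adjoint T = S"
    unfolding op_adjoint_def
  proof (rule the_equality)
    fix R :: "'a \<Rightarrow>\<^sub>L 'a" assume R: "\<forall>x y. cinner (T x) y = cinner x (R y)"
    have "x \<bullet> R y = x \<bullet> S y" for x y by (metis R Re_cinner S)
    then show "R = S" by (intro blinfun_eqI) (metis vector_eq_ldot)
  qed (simp add: cS)
  then show ?thesis by (simp add: S)
qed

lemma clinear_op_adjoint: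
  assumes "clinear_op T"
  shows "clinear_op (op_adjoint T)"
  unfolding clinear_op_def
proof (intro allI)
  fix a x
  have "y \<bullet> op_adjoint T (a *\<^sub>C x) = y \<bullet> (a *\<^sub>C op_adjoint T x)" for y
  proof -
    have "y \<bullet> op_adjoint T (a *\<^sub>C x) = T (cnj a *\<^sub>C y) \<bullet> x"
      using assms inner_adjoint[OF assms, of y "a *\<^sub>C x"]
      by (simp add: clinear_op_def inner_scaleC_left)
    also have "\<dots> = y \<bullet> (a *\<^sub>C op_adjoint T x)"
      using inner_adjoint[OF assms] by (simp add: inner_scaleC_left)
    finally show ?thesis .
  qed
  then show "op_adjoint T (a *\<^sub>C x) = a *\<^sub>C op_adjoint T x"
    by (rule vector_eq_ldot[THEN iffD1, OF allI])
qed

section \<open>Powers, Neumann series and the spectrum\<close>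

abbreviation op_pow :: "('a::real_normed_vector \<Rightarrow>\<^sub>L 'a) \<Rightarrow> nat \<Rightarrow> ('a \<Rightarrow>\<^sub>L 'a)" where
  "op_pow T n \<equiv> (((o\<^sub>L) T) ^^ n) id_blinfun"

global_interpretation blinfun_compose: bounded_bilinear "(o\<^sub>L)"
  by (rule bounded_bilinear_blinfun_compose)

lemma blinfun_compose_assoc: "(R o\<^sub>L S) o\<^sub>L T = R o\<^sub>L (S o\<^sub>L T)"
  by (rule blinfun_eqI) simp

lemma blinfun_compose_id [simp]: "T o\<^sub>L id_blinfun = T" "id_blinfun o\<^sub>L T = T"
  by (rule blinfun_eqI, simp)+

lemma op_pow_add: "op_pow T (m + n) = op_pow T m o\<^sub>L op_pow T n"
  by (induction m) (simp_all add: blinfun_compose_assoc)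

lemma op_pow_Suc_right: "op_pow T (Suc n) = op_pow T n o\<^sub>L T"
  using op_pow_add[of n 1 T] by simp

lemma norm_op_pow_le: "norm (op_pow T n) \<le> norm T ^ n"
proof (induction n)
  case (Suc n)
  have "norm (op_pow T (Suc n)) \<le> norm T * norm (op_pow T n)"
    using norm_blinfun_compose by auto
  also have "\<dots> \<le> norm T * norm T ^ n" by (intro mult_left_mono Suc) auto
  finally show ?case by simp
qed (simp add: norm_blinfun_id_le)

lemma clinear_op_id: "clinear_op id_blinfun"
  by (simp add: clinear_op_def)

lemma clinear_op_pow: "clinear_op T \<Longrightarrow> clinear_op (op_pow T n)"
  by (induction n) (simp_all add: clinear_op_id clinear_op_compose)

lemma neumann_series:
  fixes T :: "'a::banach \<Rightarrow>\<^sub>L 'a"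
  assumes "norm T < 1"
  obtains S :: "'a \<Rightarrow>\<^sub>L 'a" where "S o\<^sub>L (id_blinfun - T) = id_blinfun" "(id_blinfun - T) o\<^sub>L S = id_blinfun"
proof -
  have sum: "summable (op_pow T)"
    by (rule summable_comparison_test'[where g = "\<lambda>n. norm T ^ n" and N = 0])
       (use assms in \<open>auto intro: summable_geometric norm_op_pow_le\<close>)
  then have lim: "op_pow T \<longlonglongrightarrow> 0" by (rule summable_LIMSEQ_zero)
  define S where "S = (\<Sum>n. op_pow T n)"
  have S: "op_pow T sums S" unfolding S_def using sum by (rule summable_sums)
  have tel: "(\<lambda>n. op_pow T n - op_pow T (Suc n)) sums (op_pow T 0 - 0)"
    by (rule telescope_sums'[OF lim])
  have "(\<lambda>n. op_pow T n o\<^sub>L (id_blinfun - T)) sums (S o\<^sub>L (id_blinfun - T))"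
    by (rule bounded_linear.sums[OF blinfun_compose.bounded_linear_left S])
  moreover have "op_pow T n o\<^sub>L (id_blinfun - T) = op_pow T n - op_pow T (Suc n)" for n
    by (simp only: blinfun_compose.diff_right op_pow_Suc_right blinfun_compose_id)
  ultimately have 1: "S o\<^sub>L (id_blinfun - T) = id_blinfun"
    using tel by (simp add: sums_unique2)
  have "(\<lambda>n. (id_blinfun - T) o\<^sub>L op_pow T n) sums ((id_blinfun - T) o\<^sub>L S)"
    by (rule bounded_linear.sums[OF blinfun_compose.bounded_linear_right S])
  moreover have "(id_blinfun - T) o\<^sub>L op_pow T n = op_pow T n - op_pow T (Suc n)" for n
    by (simp add: blinfun_compose.diff_left)
  ultimately have 2: "(id_blinfun - T) o\<^sub>L S = id_blinfun"
    using tel by (simp add: sums_unique2)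
  from 1 2 show thesis by (rule that)
qed

text \<open>The type of bounded operators carries real scalars; complex multiples are formed by
  composing with this operator.\<close>

definition scaleC_op :: "complex \<Rightarrow> ('a::complex_inner \<Rightarrow>\<^sub>L 'a)" where
  "scaleC_op a = Blinfun (\<lambda>x. a *\<^sub>C x)"

lemma scaleC_op_apply [simp]: "blinfun_apply (scaleC_op a) x = a *\<^sub>C x"
  by (simp add: scaleC_op_def bounded_linear_Blinfun_apply bounded_linear_scaleC)

lemma norm_scaleC_op_le: "norm (scaleC_op a) \<le> cmod a"
  by (rule norm_blinfun_bound) (simp_all add: norm_scaleC)

lemma scaleC_diff_right: "a *\<^sub>C (x - y) = a *\<^sub>C x - a *\<^sub>C (y::'a::complex_inner)"
  by (rule complex_vector.scale_right_diff_distrib)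

lemma not_in_spectrumI:
  assumes "\<And>x. blinfun_apply S (blinfun_apply T x - z *\<^sub>C x) = x"
    and "\<And>x. blinfun_apply T (blinfun_apply S x) - z *\<^sub>C blinfun_apply S x = x"
  shows "z \<notin> op_spectrum T"
  using assms unfolding op_spectrum_def by blast

lemma not_in_spectrumE:
  fixes T :: "'a::chilbert_space \<Rightarrow>\<^sub>L 'a"
  assumes "z \<notin> op_spectrum T"
  obtains S :: "'a \<Rightarrow>\<^sub>L 'a" where "\<And>x. blinfun_apply S (blinfun_apply T x - z *\<^sub>C x) = x"
    "\<And>x. blinfun_apply T (blinfun_apply S x) - z *\<^sub>C blinfun_apply S x = x"
  using assms unfolding op_spectrum_def by blast

text \<open>For \<open>cmod z > norm T\<close>, factor \<open>T - z = - z (1 - T / z)\<close> and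
  invert the second factor by the Neumann series.\<close>

lemma spectrum_norm_le:
  fixes T :: "'a::chilbert_space \<Rightarrow>\<^sub>L 'a"
  assumes "z \<in> op_spectrum T"
  shows "cmod z \<le> norm T"
proof (rule ccontr)
  assume *: "\<not> cmod z \<le> norm T"
  then have z: "z \<noteq> 0" "cmod z > 0" using norm_ge_zero[of T] by auto
  have "norm (scaleC_op (1 / z) o\<^sub>L T) \<le> cmod (1 / z) * norm T"
    using norm_blinfun_compose norm_scaleC_op_le by (rule order_trans[OF _ mult_right_mono]) auto
  also have "\<dots> < 1" using * z by (simp add: norm_divide)
  finally obtain S :: "'a \<Rightarrow>\<^sub>L 'a" where S: "S o\<^sub>L (id_blinfun - (scaleC_op (1 / z) o\<^sub>L T)) = id_blinfun"
    "(id_blinfun - (scaleC_op (1 / z) o\<^sub>L T)) o\<^sub>L S = id_blinfun" by (rule neumann_series)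
  have S1: "S (x - (1 / z) *\<^sub>C T x) = x" for x
    using arg_cong[OF S(1), of "\<lambda>F. blinfun_apply F x"] by (simp add: blinfun.diff_left)
  have S2: "S x - (1 / z) *\<^sub>C T (S x) = x" for x
    using arg_cong[OF S(2), of "\<lambda>F. blinfun_apply F x"] by (simp add: blinfun.diff_left)
  have "z \<notin> op_spectrum T"
  proof (rule not_in_spectrumI[where S = "- (S o\<^sub>L scaleC_op (1 / z))"])
    fix x
    show "(- (S o\<^sub>L scaleC_op (1 / z))) (T x - z *\<^sub>C x) = x"
      using S1[of x] z by (simp add: blinfun.minus_left scaleC_diff_right scaleC_scaleC blinfun.diff_right)
    have "T (S ((1 / z) *\<^sub>C x)) - z *\<^sub>C S ((1 / z) *\<^sub>C x) = - (z *\<^sub>C (S ((1 / z) *\<^sub>C x) - (1 / z) *\<^sub>C T (S ((1 / z) *\<^sub>C x))))"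
      using z by (simp add: scaleC_diff_right scaleC_scaleC)
    also have "\<dots> = - x" using S2[of "(1 / z) *\<^sub>C x"] z by (simp add: scaleC_scaleC)
    finally have "- (T (S ((1 / z) *\<^sub>C x)) - z *\<^sub>C S ((1 / z) *\<^sub>C x)) = x" by simp
    then show "T ((- (S o\<^sub>L scaleC_op (1 / z))) x) - z *\<^sub>C (- (S o\<^sub>L scaleC_op (1 / z))) x = x"
      by (simp add: blinfun.minus_left blinfun.minus_right)
  qed
  with assms show False by simp
qed

text \<open>If \<open>R\<close> inverts \<open>BA - z\<close>, then \<open>z\<^sup>-\<^sup>1 (ARB - 1)\<close> inverts \<open>AB - z\<close>.\<close>

lemma spectrum_swap:
  fixes A B :: "'a::chilbert_space \<Rightarrow>\<^sub>L 'a"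
  assumes A: "clinear_op A" and B: "clinear_op B" and z: "z \<noteq> 0"
    and "z \<in> op_spectrum (A o\<^sub>L B)"
  shows "z \<in> op_spectrum (B o\<^sub>L A)"
proof (rule ccontr)
  assume "z \<notin> op_spectrum (B o\<^sub>L A)"
  then obtain R :: "'a \<Rightarrow>\<^sub>L 'a" where R: "\<And>x. R ((B o\<^sub>L A) x - z *\<^sub>C x) = x"
    "\<And>x. (B o\<^sub>L A) (R x) - z *\<^sub>C R x = x" using not_in_spectrumE by blast
  have A': "A (a *\<^sub>C x) = a *\<^sub>C A x" and B': "B (a *\<^sub>C x) = a *\<^sub>C B x" for a x
    using A B by (auto simp: clinear_op_def)
  have "z \<notin> op_spectrum (A o\<^sub>L B)"
  proof (rule not_in_spectrumI[where S = "scaleC_op (1 / z) o\<^sub>L ((A o\<^sub>L R o\<^sub>L B) - id_blinfun)"])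
    fix x
    have "R (B (A (B x) - z *\<^sub>C x)) = B x"
      using R(1)[of "B x"] by (simp add: B' blinfun.diff_right)
    then show "(scaleC_op (1 / z) o\<^sub>L ((A o\<^sub>L R o\<^sub>L B) - id_blinfun)) ((A o\<^sub>L B) x - z *\<^sub>C x) = x"
      using z by (simp add: blinfun.diff_left scaleC_scaleC)
    have "A (B (A (R (B x)))) - z *\<^sub>C A (R (B x)) = A (B x)"
      using arg_cong[OF R(2)[of "B x"], of "blinfun_apply A"] by (simp add: A' blinfun.diff_right)
    then have "(1 / z) *\<^sub>C ((A (B (A (R (B x)))) - z *\<^sub>C A (R (B x))) - A (B x) + z *\<^sub>C x) = x"
      using z by (simp add: scaleC_scaleC)
    then show "(A o\<^sub>L B) ((scaleC_op (1 / z) o\<^sub>L ((A o\<^sub>L R o\<^sub>L B) - id_blinfun)) x) -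
        z *\<^sub>C (scaleC_op (1 / z) o\<^sub>L ((A o\<^sub>L R o\<^sub>L B) - id_blinfun)) x = x"
      using z by (simp add: blinfun.diff_left A' B' scaleC_scaleC blinfun.diff_right scaleC_diff_right
        scaleC_add_right algebra_simps)
  qed
  with assms show False by simp
qed

lemma norm_cinner_le: "cmod (cinner x y) \<le> norm x * norm y"
proof (cases "cinner x y = 0")
  case False
  \<comment> \<open>The unimodular factor that rotates the inner product onto the positive real
    axis, which reduces the claim to the real Cauchy-Schwarz inequality.\<close>
  define u where "u = cnj (cinner x y) / cmod (cinner x y)"
  have "cmod (cinner x y) = Re (u * cinner x y)"
    using False by (simp add: u_def complex_norm_square[symmetric] mult.commute power2_eq_square
      flip: of_real_mult of_real_divide of_real_power)
  also have "\<dots> = (u *\<^sub>C x) \<bullet> y" by (simp flip: Re_cinner add: cinner_scaleC_left)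
  also have "\<dots> \<le> norm (u *\<^sub>C x) * norm y" by (rule norm_cauchy_schwarz)
  also have "norm (u *\<^sub>C x) = norm x" using False by (simp add: norm_scaleC u_def norm_divide)
  finally show ?thesis .
qed simp

lemma bounded_linear_cinner_left: "bounded_linear (\<lambda>x. cinner x y)"
proof (rule bounded_linear_intro[where K = "norm y"])
  show "cinner (r *\<^sub>R x) y = r *\<^sub>R cinner x y" for r x
    by (simp add: cinner_scaleC_left scaleR_conv_of_real flip: scaleC_of_real)
qed (simp_all add: cinner_add_left norm_cinner_le)

section \<open>The lower bound for the spectral radius\<close>

text \<open>Without spectrum in \<open>r \<le> cmod z\<close>, the inverse of \<open>1 - w T\<close>
  exists on the closed disc of radius \<open>1 / r\<close>. Its matrix entries are continuous there
  and holomorphic inside, with Taylor coefficients \<open>cinner (op_pow T n x) y\<close>. Cauchy's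
  estimates bound these by a multiple of \<open>r ^ n\<close>, against \<open>pow\<close> and
  \<open>r < c\<close>.\<close>

lemma spectrum_lower_bound:
  fixes T :: "'a::chilbert_space \<Rightarrow>\<^sub>L 'a"
  assumes T: "clinear_op T" and r: "0 < r" "r < c" and pow: "\<And>n. c ^ n \<le> norm (op_pow T n)"
  obtains z where "z \<in> op_spectrum T" "r \<le> cmod z"
proof (rule ccontr)
  note [simp] = blinfun.diff_left blinfun.diff_right blinfun.minus_left blinfun.minus_right
    scaleC_diff_right scaleC_scaleC
  assume "\<not> thesis"
  with that have notin: "z \<notin> op_spectrum T" if "r \<le> cmod z" for z using that by blast
  have T': "T (a *\<^sub>C x) = a *\<^sub>C T x" for a x using T by (simp add: clinear_op_def)
  \<comment> \<open>With \<open>w = 1 / z\<close> the point at infinity becomes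
    \<open>w = 0\<close>, where the inverse is the identity.\<close>
  define D where "D = cball (0::complex) (1 / r)"
  have "\<exists>S :: 'a \<Rightarrow>\<^sub>L 'a. \<forall>x. S (x - w *\<^sub>C T x) = x \<and> S x - w *\<^sub>C T (S x) = x" if "w \<in> D" for w
  proof (cases "w = 0")
    case True
    then show ?thesis by (intro exI[of _ id_blinfun]) simp
  next
    case False
    have "cmod w \<le> 1 / r" using that by (simp add: D_def)
    then have "r \<le> cmod (1 / w)" using False r by (simp add: norm_divide field_simps)
    then obtain S :: "'a \<Rightarrow>\<^sub>L 'a" where S: "\<And>x. S (T x - (1 / w) *\<^sub>C x) = x"
      "\<And>x. T (S x) - (1 / w) *\<^sub>C S x = x" using notin not_in_spectrumE by blast
    show ?thesis
    proof (intro exI[of _ "- (S o\<^sub>L scaleC_op (1 / w))"] allI conjI)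
      fix x
      show "(- (S o\<^sub>L scaleC_op (1 / w))) (x - w *\<^sub>C T x) = x"
        using S(1)[of x] False by simp
      have "w *\<^sub>C (T (S ((1 / w) *\<^sub>C x)) - (1 / w) *\<^sub>C S ((1 / w) *\<^sub>C x)) = x"
        using S(2)[of "(1 / w) *\<^sub>C x"] False by simp
      then show "(- (S o\<^sub>L scaleC_op (1 / w))) x - w *\<^sub>C T ((- (S o\<^sub>L scaleC_op (1 / w))) x) = x"
        using False by simp
    qed
  qed
  then obtain R :: "complex \<Rightarrow> ('a \<Rightarrow>\<^sub>L 'a)" where
    R1: "\<And>w x. w \<in> D \<Longrightarrow> R w (x - w *\<^sub>C T x) = x" and
    R2: "\<And>w x. w \<in> D \<Longrightarrow> R w x - w *\<^sub>C T (R w x) = x" by metis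
  have Rlin: "R w (a *\<^sub>C x) = a *\<^sub>C R w x" if "w \<in> D" for w a x
  proof -
    have "a *\<^sub>C x = a *\<^sub>C R w x - w *\<^sub>C T (a *\<^sub>C R w x)"
      using arg_cong[OF R2[OF that, of x], of "\<lambda>v. a *\<^sub>C v"] by (simp add: T' mult.commute)
    then show ?thesis using R1[OF that, of "a *\<^sub>C R w x"] by simp
  qed
  have resolvent: "R w x - R w0 x = (w - w0) *\<^sub>C R w (T (R w0 x))" if "w \<in> D" "w0 \<in> D" for w w0 x
  proof -
    define v where "v = R w0 x"
    have "R w x = R w (v - w0 *\<^sub>C T v)" using R2[OF that(2), of x] by (simp add: v_def)
    moreover have "v = R w (v - w *\<^sub>C T v)" using R1[OF that(1)] by simp
    ultimately have "R w x - v = R w (v - w0 *\<^sub>C T v) - R w (v - w *\<^sub>C T v)" by simp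
    also have "\<dots> = (w - w0) *\<^sub>C R w (T v)"
      by (simp add: Rlin[OF that(1)] complex_vector.scale_left_diff_distrib)
    finally show ?thesis unfolding v_def .
  qed
  have R_norm_diff: "norm (R w - R w0) \<le> cmod (w - w0) * norm (R w) * (norm T * norm (R w0))"
    if "w \<in> D" "w0 \<in> D" for w w0
  proof (rule norm_blinfun_bound)
    fix x
    have "norm ((R w - R w0) x) = cmod (w - w0) * norm (R w (T (R w0 x)))"
      using resolvent[OF that, of x] by (simp add: norm_scaleC)
    also have "\<dots> \<le> cmod (w - w0) * (norm (R w) * (norm T * (norm (R w0) * norm x)))"
      by (intro mult_left_mono norm_blinfun[THEN order_trans] norm_blinfun) auto
    finally show "norm ((R w - R w0) x) \<le> cmod (w - w0) * norm (R w) * (norm T * norm (R w0)) * norm x"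
      by (simp add: mult_ac)
  qed simp
  have contR: "continuous_on D R"
    unfolding continuous_on_iff
  proof (intro ballI allI impI)
    fix w0 and e :: real assume w0: "w0 \<in> D" and e: "0 < e"
    define K where "K = norm T * norm (R w0)"
    define L where "L = 2 * norm (R w0) * K"
    have K: "K \<ge> 0" "L \<ge> 0" unfolding K_def L_def by simp_all
    \<comment> \<open>The first bound forces \<open>norm (R w) \<le> 2 * norm (R w0)\<close>, which
      removes the unknown \<open>norm (R w)\<close> from \<open>R_norm_diff\<close>; the second then
      makes the difference small.\<close>
    define d where "d = min (1 / (2 * (K + 1))) (e / (L + 1))"
    have "dist (R w) (R w0) < e" if w: "w \<in> D" "dist w w0 < d" for w
    proof -
      have dw: "cmod (w - w0) < 1 / (2 * (K + 1))" "cmod (w - w0) < e / (L + 1)"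
        using w by (auto simp: d_def dist_norm)
      have le: "norm (R w - R w0) \<le> cmod (w - w0) * norm (R w) * K"
        using R_norm_diff[OF w(1) w0] by (simp add: K_def)
      have "cmod (w - w0) * K \<le> 1 / (2 * (K + 1)) * K" using dw K by (intro mult_right_mono) auto
      also have "\<dots> \<le> 1 / 2" using K by (simp add: field_simps)
      finally have "cmod (w - w0) * K * norm (R w) \<le> 1 / 2 * norm (R w)" by (intro mult_right_mono) auto
      with le have "norm (R w - R w0) \<le> norm (R w) / 2" by (simp add: mult_ac)
      moreover have "norm (R w) \<le> norm (R w0) + norm (R w - R w0)"
        using norm_triangle_ineq[of "R w0" "R w - R w0"] by simp
      ultimately have "norm (R w) \<le> 2 * norm (R w0)" by simp
      with le have "norm (R w - R w0) \<le> cmod (w - w0) * (2 * norm (R w0)) * K"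
        using K by (meson mult_left_mono mult_right_mono norm_ge_zero order_trans)
      also have "\<dots> = cmod (w - w0) * L" by (simp add: L_def mult_ac)
      also have "\<dots> \<le> cmod (w - w0) * (L + 1)" by (intro mult_left_mono) auto
      also have "\<dots> < e" using dw(2) K by (simp add: field_simps)
      finally show ?thesis by (simp add: dist_norm)
    qed
    moreover have "d > 0" unfolding d_def using K e by simp
    ultimately show "\<exists>d>0. \<forall>w\<in>D. dist w w0 < d \<longrightarrow> dist (R w) (R w0) < e" by blast
  qed
  have "compact (R ` D)" by (rule compact_continuous_image[OF contR]) (simp add: D_def)
  then obtain B where B: "\<And>w. w \<in> D \<Longrightarrow> norm (R w) \<le> B" "B > 0"
    using compact_imp_bounded bounded_pos by (metis image_eqI)
  have main: "cmod (cinner (op_pow T n x) y) \<le> B * norm x * norm y * r ^ n" for n x y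
  proof -
    define f where "f w = cinner (R w x) y" for w
    have contf: "continuous_on D f"
      unfolding f_def
      by (intro bounded_linear.continuous_on[OF bounded_linear_cinner_left]
          bounded_linear.continuous_on[OF blinfun.bounded_linear_left] contR)
    have "f field_differentiable (at w0)" if "w0 \<in> ball 0 (1 / r)" for w0
    proof -
      define g where "g w = cinner (R w (T (R w0 x))) y" for w
      have w0: "w0 \<in> D" and ev: "eventually (\<lambda>w. w \<in> ball 0 (1/r)) (at w0)"
        using that eventually_at_in_open'[of "ball 0 (1/r)" w0] by (auto simp: D_def)
      have "continuous_on (ball 0 (1/r)) g"
        unfolding g_def
        by (intro bounded_linear.continuous_on[OF bounded_linear_cinner_left]
          bounded_linear.continuous_on[OF blinfun.bounded_linear_left] continuous_on_subset[OF contR])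
          (auto simp: D_def)
      then have "(g \<longlongrightarrow> g w0) (at w0)"
        using that by (simp add: continuous_on_eq_continuous_at isCont_def)
      \<comment> \<open>By the resolvent identity the difference quotient equals \<open>g\<close>,
        so continuity of the resolvent already yields the derivative.\<close>
      moreover have "eventually (\<lambda>w. g w = (f w - f w0) / (w - w0)) (at w0)"
        using ev eventually_neq_at_within[of w0]
      proof eventually_elim
        case (elim w)
        have "f w - f w0 = cinner (R w x - R w0 x) y"
          unfolding f_def by (simp add: linear_diff[OF bounded_linear.linear[OF bounded_linear_cinner_left]])
        also have "\<dots> = (w - w0) * g w"
          using elim w0 by (subst resolvent) (auto simp: D_def g_def cinner_scaleC_left)
        finally show ?case using elim by simp
      qed
      ultimately have "((\<lambda>w. (f w - f w0) / (w - w0)) \<longlongrightarrow> g w0) (at w0)"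
        by (rule Lim_transform_eventually)
      then show ?thesis
        unfolding field_differentiable_def has_field_derivative_iff by blast
    qed
    then have holf: "f holomorphic_on ball 0 (1 / r)"
      by (simp add: holomorphic_on_def field_differentiable_at_within)
    have fB: "cmod (f w) \<le> B * norm x * norm y" if "w \<in> D" for w
    proof -
      have "cmod (f w) \<le> norm (R w x) * norm y" unfolding f_def by (rule norm_cinner_le)
      also have "\<dots> \<le> norm (R w) * norm x * norm y" by (intro mult_right_mono norm_blinfun) auto
      also have "\<dots> \<le> B * norm x * norm y" by (intro mult_right_mono B that) auto
      finally show ?thesis .
    qed
    have expand: "R w x = (\<Sum>k<n. w ^ k *\<^sub>C op_pow T k x) + w ^ n *\<^sub>C op_pow T n (R w x)" if "w \<in> D" for w n
    proof (induction n)
      case (Suc n)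
      have "op_pow T n (R w x) = op_pow T n (x + w *\<^sub>C T (R w x))"
        using R2[OF that, of x] by (simp add: algebra_simps)
      also have "\<dots> = op_pow T n x + w *\<^sub>C op_pow T (Suc n) (R w x)"
        using clinear_op_pow[OF T, of n] op_pow_Suc_right[of n T]
        by (simp add: blinfun.add_right clinear_op_def del: funpow.simps)
      finally show ?case
        by (subst Suc) (simp add: scaleC_add_right mult.commute del: funpow.simps)
    qed simp
    have sums: "(\<lambda>n. cinner (op_pow T n x) y * w ^ n) sums f w"
      if w: "w \<in> D" "cmod w * norm T < 1" for w
    proof -
      have "f w - (\<Sum>k<n. cinner (op_pow T k x) y * w ^ k) = w ^ n * cinner (op_pow T n (R w x)) y" for n
      proof -
        interpret cl: bounded_linear "\<lambda>x. cinner x y" by (rule bounded_linear_cinner_left)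
        show ?thesis
          unfolding f_def by (subst expand[OF w(1), of n]) (simp add: cl.add cl.sum cinner_scaleC_left mult.commute)
      qed
      moreover have "(\<lambda>n. w ^ n * cinner (op_pow T n (R w x)) y) \<longlonglongrightarrow> 0"
      proof (rule tendsto_0_le[where K = "norm (R w x) * norm y"])
        show "(\<lambda>n. (cmod w * norm T) ^ n) \<longlonglongrightarrow> 0" using w by (intro LIMSEQ_realpow_zero) auto
        have "cmod (w ^ n * cinner (op_pow T n (R w x)) y) \<le> (cmod w * norm T) ^ n * (norm (R w x) * norm y)" for n
        proof -
          have "cmod (cinner (op_pow T n (R w x)) y) \<le> norm (op_pow T n) * norm (R w x) * norm y"
            by (intro norm_cinner_le[THEN order_trans] mult_right_mono norm_blinfun) auto
          also have "\<dots> \<le> norm T ^ n * norm (R w x) * norm y"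
            by (intro mult_right_mono norm_op_pow_le) auto
          finally have "cmod w ^ n * cmod (cinner (op_pow T n (R w x)) y) \<le> cmod w ^ n * (norm T ^ n * norm (R w x) * norm y)"
            by (intro mult_left_mono) auto
          then show ?thesis by (simp add: norm_mult norm_power power_mult_distrib mult_ac)
        qed
        then show "\<forall>\<^sub>F n in sequentially. norm (w ^ n * cinner (op_pow T n (R w x)) y)
            \<le> norm ((cmod w * norm T) ^ n) * (norm (R w x) * norm y)" by simp
      qed
      ultimately have "(\<lambda>n. f w - (\<Sum>k<n. cinner (op_pow T k x) y * w ^ k)) \<longlonglongrightarrow> 0" by simp
      from tendsto_diff[OF tendsto_const[of "f w"] this] show ?thesis unfolding sums_def by simp
    qed
    \<comment> \<open>Convergence of the power series is known where
      \<open>cmod w * norm T < 1\<close>. This small disc suffices to identify the Taylor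
      coefficients at 0, while Cauchy's estimate uses the full radius \<open>1 / r\<close>.\<close>
    have "eventually (\<lambda>w. w \<in> ball 0 (min (1 / r) (1 / (norm T + 1)))) (nhds (0::complex))"
      using r by (intro eventually_nhds_in_open) (auto intro: add_nonneg_pos)
    then have "eventually (\<lambda>w. (\<lambda>n. fps_nth (Abs_fps (\<lambda>n. cinner (op_pow T n x) y)) n * w ^ n) sums f w) (nhds 0)"
    proof eventually_elim
      case (elim w)
      have "cmod w * norm T \<le> cmod w * (norm T + 1)" by (intro mult_left_mono) auto
      also have "\<dots> < 1" using elim norm_ge_zero[of T] by (simp add: field_simps add_nonneg_pos)
      finally show ?case using sums[of w] elim by (simp add: D_def)
    qed
    from fps_nth_fps_expansion[OF has_fps_expansionI[OF this], of n]
    have "(deriv ^^ n) f 0 = fact n * cinner (op_pow T n x) y" by simp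
    moreover have "cmod ((deriv ^^ n) f 0) \<le> fact n * (B * norm x * norm y) / (1 / r) ^ n"
      using r contf by (intro Cauchy_inequality holf fB) (auto simp: D_def)
    ultimately show ?thesis using r by (simp add: norm_mult power_divide)
  qed
  have "norm (op_pow T n) \<le> B * r ^ n" for n
  proof (rule norm_blinfun_bound)
    show "norm (op_pow T n x) \<le> B * r ^ n * norm x" for x
    proof (cases "op_pow T n x = 0")
      case False
      \<comment> \<open>The choice \<open>y = op_pow T n x\<close> in \<open>main\<close> turns the
        bound on matrix entries into one on the norm.\<close>
      have "norm (op_pow T n x) * norm (op_pow T n x) = Re (cinner (op_pow T n x) (op_pow T n x))"
        by (simp add: Re_cinner power2_norm_eq_inner flip: power2_eq_square)
      also have "\<dots> \<le> B * norm x * norm (op_pow T n x) * r ^ n"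
        by (rule order_trans[OF complex_Re_le_cmod main])
      finally show ?thesis using False by (simp add: mult_ac)
    qed (use B r in simp)
  qed (use B r in simp)
  with pow have "c ^ n \<le> B * r ^ n" for n using order_trans by blast
  then have "(c / r) ^ n \<le> B" for n using r by (simp add: power_divide field_simps)
  moreover obtain n where "B < (c / r) ^ n" using real_arch_pow[of "c / r" B] r by auto
  ultimately show False by (simp add: not_le[symmetric])
qed

section \<open>Polynomials in a self-adjoint operator\<close>

lemma op_poly_eq_sum:
  assumes "degree p \<le> n"
  shows "op_poly p A = (\<Sum>i\<le>n. coeff p i *\<^sub>R op_pow A i)"
  unfolding op_poly_def
  by (rule sum.mono_neutral_left) (use assms in \<open>auto simp: coeff_eq_0\<close>)

lemma op_poly_0 [simp]: "op_poly 0 A = 0"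
  by (simp add: op_poly_def)

lemma op_poly_pCons: "op_poly (pCons a p) A = a *\<^sub>R id_blinfun + (A o\<^sub>L op_poly p A)"
proof -
  have "degree (pCons a p) \<le> Suc (degree p)" by (rule degree_pCons_le)
  from op_poly_eq_sum[OF this, of A]
  have "op_poly (pCons a p) A = a *\<^sub>R id_blinfun + (\<Sum>i\<le>degree p. coeff p i *\<^sub>R (A o\<^sub>L op_pow A i))"
    by (simp add: sum.atMost_Suc_shift del: sum.atMost_Suc)
  then show ?thesis
    by (simp add: op_poly_def blinfun_compose.sum_right blinfun_compose.scaleR_right)
qed

lemma op_poly_add: "op_poly (p + q) A = op_poly p A + op_poly q A"
  by (induction p q rule: poly_induct2)
     (simp_all add: op_poly_pCons scaleR_add_left blinfun_compose.add_right)

lemma op_poly_smult: "op_poly (smult a p) A = a *\<^sub>R op_poly p A"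
  by (induction p) (simp_all add: op_poly_pCons scaleR_add_right blinfun_compose.scaleR_right)

lemma op_poly_diff: "op_poly (p - q) A = op_poly p A - op_poly q A"
  using op_poly_add[of p "- q" A] op_poly_smult[of "- 1" q A] by simp

lemma op_poly_mult: "op_poly (p * q) A = op_poly p A o\<^sub>L op_poly q A"
  by (induction p)
     (simp_all add: op_poly_pCons op_poly_add op_poly_smult blinfun_compose.add_left
       blinfun_compose.scaleR_left blinfun_compose_assoc)

lemma op_poly_const: "op_poly [:a:] A = a *\<^sub>R id_blinfun"
  by (simp add: op_poly_pCons)

lemma op_poly_X: "op_poly [:0, 1:] A = A"
  by (simp add: op_poly_pCons)

lemma op_poly_linear: "op_poly [:- a, 1:] A = A - a *\<^sub>R id_blinfun"
  by (simp add: op_poly_pCons)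

section \<open>Lower bounds and norms for polynomials in a self-adjoint operator\<close>

definition selfadjoint_op :: "('a::real_inner \<Rightarrow>\<^sub>L 'a) \<Rightarrow> bool" where
  "selfadjoint_op A \<longleftrightarrow> (\<forall>x y. blinfun_apply A x \<bullet> y = x \<bullet> blinfun_apply A y)"

definition positive_op :: "('a::chilbert_space \<Rightarrow>\<^sub>L 'a) \<Rightarrow> bool" where
  "positive_op A \<longleftrightarrow> clinear_op A \<and> selfadjoint_op A \<and> (\<forall>x. 0 \<le> blinfun_apply A x \<bullet> x)"

text \<open>For \<open>A - a\<close>, failure of this property makes \<open>a\<close> an approximate
  eigenvalue. It passes to products of factors and, unlike invertibility, involves no control of
  ranges.\<close>

definition bounded_below_op :: "('a::real_normed_vector \<Rightarrow>\<^sub>L 'a) \<Rightarrow> bool" where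
  "bounded_below_op A \<longleftrightarrow> (\<exists>c>0. \<forall>x. c * norm x \<le> norm (blinfun_apply A x))"

lemma bounded_below_op_compose:
  assumes "bounded_below_op A" "bounded_below_op B"
  shows "bounded_below_op (A o\<^sub>L B)"
proof -
  obtain c where c: "c > 0" "\<And>x. c * norm x \<le> norm (A x)" using assms unfolding bounded_below_op_def by blast
  obtain d where d: "d > 0" "\<And>x. d * norm x \<le> norm (B x)" using assms unfolding bounded_below_op_def by blast
  have "c * d * norm x \<le> norm ((A o\<^sub>L B) x)" for x
  proof -
    have "c * (d * norm x) \<le> c * norm (B x)" using c d by (intro mult_left_mono) auto
    also have "\<dots> \<le> norm (A (B x))" by (rule c)
    finally show ?thesis by (simp add: mult.assoc)
  qed
  then show ?thesis unfolding bounded_below_op_def using c d mult_pos_pos by blast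
qed

lemma selfadjoint_op_poly:
  assumes "selfadjoint_op A"
  shows "selfadjoint_op (op_poly p A)"
proof (induction p)
  case (pCons a p)
  have comm: "A o\<^sub>L op_poly p A = op_poly p A o\<^sub>L A"
    using op_poly_mult[of "[:0,1:]" p A] op_poly_mult[of p "[:0,1:]" A] by (simp add: op_poly_X mult.commute)
  have "(A o\<^sub>L op_poly p A) x \<bullet> y = x \<bullet> (A o\<^sub>L op_poly p A) y" for x y
    using assms pCons.IH by (subst (2) comm) (simp add: selfadjoint_op_def)
  then show ?case
    by (simp add: selfadjoint_op_def op_poly_pCons blinfun.add_left blinfun.scaleR_left
      inner_add_left inner_add_right)
qed (simp add: selfadjoint_op_def)

lemma clinear_op_poly:
  assumes "clinear_op A"
  shows "clinear_op (op_poly p A)"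
proof (induction p)
  case (pCons a p)
  then show ?case using assms
    by (simp add: clinear_op_def op_poly_pCons blinfun.add_left blinfun.scaleR_left scaleC_add_right
        scaleC_scaleC mult.commute flip: scaleC_of_real)
qed (simp add: clinear_op_def)

lemma poly_map_of_real_add:
  "poly (map_poly complex_of_real (p + q)) z = poly (map_poly of_real p) z + poly (map_poly of_real q) z"
  by (induction p q rule: poly_induct2) (simp_all add: map_poly_pCons algebra_simps)

lemma poly_map_of_real_smult:
  "poly (map_poly complex_of_real (smult a p)) z = of_real a * poly (map_poly of_real p) z"
  by (induction p) (simp_all add: map_poly_pCons algebra_simps)

lemma poly_map_of_real_mult:
  "poly (map_poly complex_of_real (p * q)) z = poly (map_poly of_real p) z * poly (map_poly of_real q) z"
  by (induction p) (simp_all add: map_poly_pCons poly_map_of_real_add poly_map_of_real_smult algebra_simps)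

lemma poly_map_of_real_of_real:
  "poly (map_poly complex_of_real p) (of_real x) = of_real (poly p x)"
  by (induction p) (simp_all add: map_poly_pCons)

text \<open>A complex root \<open>z\<close> exists. If it is not real, the remainder of
  \<open>p\<close> modulo the real quadratic with roots \<open>z\<close> and \<open>cnj z\<close>
  has degree below 2 and still vanishes at \<open>z\<close>, hence is 0.\<close>

lemma real_poly_root_or_quadratic_factor:
  fixes p :: "real poly"
  assumes "degree p > 0"
  obtains a where "poly p a = 0" | a b q where "b \<noteq> 0" "p = ([:- a, 1:]\<^sup>2 + [:b\<^sup>2:]) * q"
proof -
  define P where "P = map_poly complex_of_real p"
  have "degree P > 0" using assms by (simp add: P_def degree_map_poly)
  then have "\<exists>z. poly P z = 0" by (rule alg_closed_imp_poly_has_root)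
  then obtain z where z: "poly P z = 0" ..
  show thesis
  proof (cases "Im z = 0")
    case True
    then have "complex_of_real (Re z) = z" by (simp add: complex_eq_iff)
    then have "complex_of_real (poly p (Re z)) = 0"
      using z poly_map_of_real_of_real[of p "Re z"] unfolding P_def by simp
    then show thesis using that(1) by simp
  next
    case False
    define s where "s = [:- Re z, 1:]\<^sup>2 + [:(Im z)\<^sup>2:]"
    have s: "s = [:(Re z)\<^sup>2 + (Im z)\<^sup>2, - 2 * Re z, 1:]"
      by (simp add: s_def power2_eq_square algebra_simps)
    define u v where "u = coeff (p mod s) 1" and "v = coeff (p mod s) 0"
    have "s \<noteq> 0" "degree s = 2" unfolding s by simp_all
    then have deg: "degree (p mod s) < 2"
      using degree_mod_less[of s p] by (cases "p mod s = 0") auto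
    have uv: "p mod s = [:v, u:]"
    proof (rule poly_eqI)
      fix n :: nat
      consider "n = 0" | "n = 1" | m where "n = Suc (Suc m)" by (metis One_nat_def not0_implies_Suc)
      then show "coeff (p mod s) n = coeff [:v, u:] n"
      proof cases
        case 3
        then show ?thesis using deg by (simp add: coeff_eq_0)
      qed (simp_all add: u_def v_def)
    qed
    have "poly (map_poly complex_of_real s) z = 0"
      by (simp add: s map_poly_pCons complex_eq_iff power2_eq_square algebra_simps)
    then have "poly (map_poly complex_of_real (p div s * s + p mod s)) z = poly (map_poly complex_of_real (p mod s)) z"
      by (simp only: poly_map_of_real_add poly_map_of_real_mult) simp
    then have "complex_of_real v + z * complex_of_real u = 0"
      using z unfolding div_mult_mod_eq P_def by (simp add: uv map_poly_pCons)
    \<comment> \<open>The imaginary part of the equation is \<open>Im z * u\<close>, which gives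
      \<open>u = 0\<close> first.\<close>
    then have "u = 0" "v = 0" using False by (auto simp: complex_eq_iff)
    with uv have "p mod s = 0" by simp
    then have "p = s * (p div s)" using mult_div_mod_eq[of s p] by (metis add.right_neutral)
    then show thesis using that(2)[of "Im z" "Re z" "p div s"] False unfolding s_def by blast
  qed
qed

text \<open>Induction on the degree by splitting off real factors. Linear ones are covered by the
  assumption on roots; an irreducible quadratic gives \<open>(A - a)^2 + b^2\<close>, which for
  self-adjoint \<open>A\<close> is bounded below by \<open>b^2\<close>.\<close>

lemma bounded_below_op_poly:
  fixes A :: "'a::chilbert_space \<Rightarrow>\<^sub>L 'a"
  assumes A: "selfadjoint_op A"
  shows "q \<noteq> 0 \<Longrightarrow> (\<And>a. poly q a = 0 \<Longrightarrow> bounded_below_op (A - a *\<^sub>R id_blinfun)) \<Longrightarrow>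
    bounded_below_op (op_poly q A)"
proof (induction "degree q" arbitrary: q rule: less_induct)
  case less
  consider "degree q = 0" | "degree q > 0" by blast
  then show ?case
  proof cases
    case 1
    then obtain a where a: "q = [:a:]" by (rule degree_eq_zeroE)
    with less.prems have "a \<noteq> 0" by auto
    then show ?thesis unfolding bounded_below_op_def
      by (intro exI[of _ "\<bar>a\<bar>"]) (simp add: a op_poly_const blinfun.scaleR_left)
  next
    case 2
    then show ?thesis
    proof (cases rule: real_poly_root_or_quadratic_factor)
      case (1 a)
      then obtain p where p: "q = [:- a, 1:] * p" by (auto simp: poly_eq_0_iff_dvd elim: dvdE)
      with less.prems have "p \<noteq> 0" by auto
      then have "degree p < degree q" unfolding p by (subst degree_mult_eq) auto
      then have "bounded_below_op (op_poly p A)"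
        using less.prems \<open>p \<noteq> 0\<close> by (intro less.hyps) (auto simp: p)
      moreover have "bounded_below_op (A - a *\<^sub>R id_blinfun)" using less.prems 1 by blast
      ultimately show ?thesis unfolding p op_poly_mult op_poly_linear by (intro bounded_below_op_compose)
    next
      case (2 a b p)
      with less.prems have "p \<noteq> 0" by auto
      define s where "s = [:- a, 1:]\<^sup>2 + [:b\<^sup>2:]"
      have "s = [:a\<^sup>2 + b\<^sup>2, - 2 * a, 1:]" by (simp add: s_def power2_eq_square algebra_simps)
      then have "degree s = 2" by simp
      then have "degree p < degree q"
        unfolding 2(2) s_def[symmetric] using \<open>p \<noteq> 0\<close> by (subst degree_mult_eq) auto
      then have bp: "bounded_below_op (op_poly p A)"
        using less.prems \<open>p \<noteq> 0\<close> by (intro less.hyps) (auto simp: 2(2))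
      define C where "C = op_poly [:- a, 1:] A"
      have s_op: "op_poly s A = (C o\<^sub>L C) + b\<^sup>2 *\<^sub>R id_blinfun"
        by (simp only: s_def op_poly_add power2_eq_square op_poly_mult op_poly_const C_def)
      have "b\<^sup>2 * norm x \<le> norm (op_poly s A x)" for x
      proof (cases "x = 0")
        case False
        have "b\<^sup>2 * (norm x * norm x) \<le> C x \<bullet> C x + b\<^sup>2 * (x \<bullet> x)"
          by (simp add: power2_norm_eq_inner flip: power2_eq_square)
        also have "\<dots> = op_poly s A x \<bullet> x"
          using selfadjoint_op_poly[OF A, of "[:- a, 1:]"]
          unfolding s_op C_def
          by (simp add: selfadjoint_op_def blinfun.add_left blinfun.scaleR_left inner_add_left)
        also have "\<dots> \<le> norm (op_poly s A x) * norm x" by (rule norm_cauchy_schwarz)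
        finally show ?thesis using False by (simp flip: mult.assoc)
      qed (simp add: blinfun.zero_right)
      then have "bounded_below_op (op_poly s A)"
        unfolding bounded_below_op_def using 2(1) by (intro exI[of _ "b\<^sup>2"]) auto
      then show ?thesis
        unfolding 2(2) s_def[symmetric] op_poly_mult using bp by (intro bounded_below_op_compose)
    qed
  qed
qed

text \<open>Squaring a lower bound \<open>d\<close> for \<open>P^2 - M^2\<close>, where
  \<open>M = norm P\<close>, yields
  \<open>norm (P x)^2 \<le> (M^2 - d^2 / M^2) * norm x ^ 2\<close>. This would make the norm of
  \<open>P\<close> smaller than \<open>M\<close>.\<close>

lemma not_bounded_below_norm:
  fixes P :: "'a::real_inner \<Rightarrow>\<^sub>L 'a"
  assumes P: "selfadjoint_op P" "P \<noteq> 0"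
  shows "\<not> bounded_below_op ((P o\<^sub>L P) - (norm P)\<^sup>2 *\<^sub>R id_blinfun)"
proof
  define M where "M = norm P"
  have M: "M > 0" using P by (simp add: M_def)
  assume "bounded_below_op ((P o\<^sub>L P) - (norm P)\<^sup>2 *\<^sub>R id_blinfun)"
  then obtain d where d: "d > 0" "\<And>x. d * norm x \<le> norm (P (P x) - M\<^sup>2 *\<^sub>R x)"
    unfolding bounded_below_op_def by (auto simp: blinfun.diff_left blinfun.scaleR_left M_def)
  have le: "(norm (P x))\<^sup>2 \<le> (M\<^sup>2 - d\<^sup>2 / M\<^sup>2) * (norm x)\<^sup>2" for x
  proof -
    have "(d * norm x)\<^sup>2 \<le> (norm (P (P x) - M\<^sup>2 *\<^sub>R x))\<^sup>2" using d by (intro power_mono) auto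
    also have "\<dots> = (norm (P (P x)))\<^sup>2 - 2 * M\<^sup>2 * (P (P x) \<bullet> x) + M ^ 4 * (norm x)\<^sup>2"
      unfolding power2_norm_eq_inner
      by (simp add: inner_diff_left inner_diff_right inner_commute algebra_simps power_numeral_reduce)
    also have "P (P x) \<bullet> x = (norm (P x))\<^sup>2" using P by (simp add: selfadjoint_op_def power2_norm_eq_inner)
    also have "(norm (P (P x)))\<^sup>2 \<le> (M * norm (P x))\<^sup>2"
      unfolding M_def by (intro power_mono norm_blinfun) auto
    finally have "d\<^sup>2 * (norm x)\<^sup>2 \<le> M\<^sup>2 * (M\<^sup>2 * (norm x)\<^sup>2 - (norm (P x))\<^sup>2)"
      by (simp add: power_mult_distrib algebra_simps power_numeral_reduce)
    then show ?thesis using M by (simp add: field_simps power_mult_distrib)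
  qed
  define N where "N = sqrt (M\<^sup>2 - d\<^sup>2 / M\<^sup>2)"
  have "norm P \<le> N"
  proof (rule norm_blinfun_bound)
    obtain x where "P x \<noteq> 0" using P(2) blinfun_eqI[of P 0] by auto
    then have x: "x \<noteq> 0" by (auto simp: blinfun.zero_right)
    have "0 \<le> (M\<^sup>2 - d\<^sup>2 / M\<^sup>2) * (norm x)\<^sup>2" using le[of x] zero_le_power2 order_trans by blast
    then have nn: "0 \<le> M\<^sup>2 - d\<^sup>2 / M\<^sup>2" using x by (simp add: zero_le_mult_iff)
    then show "0 \<le> N" by (simp add: N_def)
    show "norm (P x) \<le> N * norm x" for x
    proof (rule power2_le_imp_le)
      have "N\<^sup>2 = M\<^sup>2 - d\<^sup>2 / M\<^sup>2" unfolding N_def using nn by (rule real_sqrt_pow2)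
      then show "(norm (P x))\<^sup>2 \<le> (N * norm x)\<^sup>2" using le[of x] by (simp only: power_mult_distrib)
      show "0 \<le> N * norm x" using \<open>0 \<le> N\<close> by simp
    qed
  qed
  also have "N < sqrt (M\<^sup>2)"
    unfolding N_def using d(1) M by (intro real_sqrt_less_mono) simp
  also have "\<dots> = M" using M by simp
  finally show False by (simp add: M_def)
qed

text \<open>With \<open>M = \<parallel>p(A)\<parallel>\<close> the operator \<open>p(A)\<^sup>2 - M\<^sup>2\<close> is not bounded below, hence neither is
  \<open>A - a\<close> for some root \<open>a\<close> of \<open>p\<^sup>2 - M\<^sup>2\<close>.\<close>

lemma norm_op_poly_le_approximate_spectrum:
  fixes A :: "'a::chilbert_space \<Rightarrow>\<^sub>L 'a"
  assumes A: "selfadjoint_op A" and c: "0 \<le> c"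
    and le: "\<And>a. \<not> bounded_below_op (A - a *\<^sub>R id_blinfun) \<Longrightarrow> \<bar>poly p a\<bar> \<le> c"
  shows "norm (op_poly p A) \<le> c"
proof (rule ccontr)
  have root: "\<exists>a. poly (q\<^sup>2 - [:(norm (op_poly q A))\<^sup>2:]) a = 0 \<and> \<not> bounded_below_op (A - a *\<^sub>R id_blinfun)"
    if "op_poly q A \<noteq> 0" "q\<^sup>2 - [:(norm (op_poly q A))\<^sup>2:] \<noteq> 0" for q
    using bounded_below_op_poly[OF A that(2)] not_bounded_below_norm[OF selfadjoint_op_poly[OF A] that(1)]
    by (auto simp: op_poly_diff op_poly_mult op_poly_const power2_eq_square)
  assume "\<not> norm (op_poly p A) \<le> c"
  then have M: "norm (op_poly p A) > c" "op_poly p A \<noteq> 0" using c by auto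
  have no: "\<bar>poly p a\<bar> \<noteq> norm (op_poly p A)" if "\<not> bounded_below_op (A - a *\<^sub>R id_blinfun)" for a
    using le[OF that] M by simp
  have bb: "bounded_below_op (A - a *\<^sub>R id_blinfun)" for a
  proof (cases "p\<^sup>2 - [:(norm (op_poly p A))\<^sup>2:] = 0")
    case True
    then have "poly (p\<^sup>2 - [:(norm (op_poly p A))\<^sup>2:]) a = 0" by simp
    then have "(poly p a)\<^sup>2 = (norm (op_poly p A))\<^sup>2" by simp
    then have "\<bar>poly p a\<bar> = norm (op_poly p A)" by (metis real_sqrt_abs abs_norm_cancel)
    then show ?thesis using no by blast
  next
    case False
    from root[OF M(2) False] obtain b where b: "(poly p b)\<^sup>2 = (norm (op_poly p A))\<^sup>2" "\<not> bounded_below_op (A - b *\<^sub>R id_blinfun)"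
      by auto
    then have "\<bar>poly p b\<bar> = norm (op_poly p A)" by (metis real_sqrt_abs abs_norm_cancel)
    then show ?thesis using no b by blast
  qed
  \<comment> \<open>Every \<open>A - a\<close> is bounded below by now. Applied to the polynomial X,
    \<open>root\<close> therefore forces \<open>A = 0\<close>, and boundedness below for
    \<open>a = 0\<close> then makes the whole space trivial.\<close>
  have "[:0, 1:]\<^sup>2 - [:(norm A)\<^sup>2:] \<noteq> 0"
    by (simp add: power2_eq_square)
  then have "A = 0" using root[of "[:0, 1:]"] bb unfolding op_poly_X by blast
  with bb[of 0] obtain d where "d > 0" "\<And>x :: 'a. d * norm x \<le> 0"
    unfolding bounded_below_op_def by auto
  then have zero: "x = 0" for x :: 'a by (metis mult_le_0_iff norm_le_zero_iff not_le)
  have "op_poly p A = 0" by (intro blinfun_eqI) (rule trans[OF zero zero[symmetric]])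
  with M show False by simp
qed

section \<open>Continuous functional calculus of a positive operator\<close>

text \<open>For \<open>a < 0\<close> positivity makes \<open>(A - a) x \<bullet> x\<close> at least
  \<open>- a * norm x ^ 2\<close>; for \<open>a > norm A\<close> the triangle inequality gives the
  lower bound \<open>a - norm A\<close>.\<close>

lemma not_bounded_below_imp_interval:
  fixes A :: "'a::chilbert_space \<Rightarrow>\<^sub>L 'a"
  assumes A: "positive_op A" and not: "\<not> bounded_below_op (A - a *\<^sub>R id_blinfun)"
  shows "a \<in> {0..norm A}"
proof -
  have "0 \<le> a"
  proof (rule ccontr)
    assume "\<not> 0 \<le> a"
    have "- a * norm x \<le> norm ((A - a *\<^sub>R id_blinfun) x)" for x
    proof (cases "x = 0")
      case False
      have "- a * (norm x * norm x) \<le> A x \<bullet> x - a * (x \<bullet> x)"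
        using A by (simp add: positive_op_def power2_norm_eq_inner flip: power2_eq_square)
      also have "\<dots> = (A - a *\<^sub>R id_blinfun) x \<bullet> x"
        by (simp add: blinfun.diff_left blinfun.scaleR_left inner_diff_left)
      also have "\<dots> \<le> norm ((A - a *\<^sub>R id_blinfun) x) * norm x" by (rule norm_cauchy_schwarz)
      finally have "(- a * norm x) * norm x \<le> norm ((A - a *\<^sub>R id_blinfun) x) * norm x"
        by (simp only: mult.assoc)
      then show ?thesis by (rule mult_right_le_imp_le) (use False in simp)
    qed simp
    then have "bounded_below_op (A - a *\<^sub>R id_blinfun)"
      unfolding bounded_below_op_def using \<open>\<not> 0 \<le> a\<close> by (intro exI[of _ "- a"]) auto
    with not show False ..
  qed
  moreover have "a \<le> norm A"
  proof (rule ccontr)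
    assume gt: "\<not> a \<le> norm A"
    have "(a - norm A) * norm x \<le> norm ((A - a *\<^sub>R id_blinfun) x)" for x
    proof -
      have "norm (a *\<^sub>R x) - norm (A x) \<le> norm (A x - a *\<^sub>R x)"
        by (metis norm_minus_commute norm_triangle_ineq2)
      moreover have "norm (A x) \<le> norm A * norm x" by (rule norm_blinfun)
      ultimately show ?thesis using gt norm_ge_zero[of A]
        by (simp add: blinfun.diff_left blinfun.scaleR_left left_diff_distrib)
    qed
    then have "bounded_below_op (A - a *\<^sub>R id_blinfun)"
      unfolding bounded_below_op_def using gt by (intro exI[of _ "a - norm A"]) auto
    with not show False ..
  qed
  ultimately show ?thesis by simp
qed

lemma not_bounded_below_imp_spectrum:
  fixes A :: "'a::chilbert_space \<Rightarrow>\<^sub>L 'a"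
  assumes "\<not> bounded_below_op (A - a *\<^sub>R id_blinfun)"
  shows "complex_of_real a \<in> op_spectrum A"
proof (rule ccontr)
  assume "complex_of_real a \<notin> op_spectrum A"
  then obtain S :: "'a \<Rightarrow>\<^sub>L 'a" where S: "\<And>x. S (A x - complex_of_real a *\<^sub>C x) = x"
    using not_in_spectrumE by blast
  \<comment> \<open>Adding 1 keeps the constant positive even if \<open>S = 0\<close>.\<close>
  have "norm x \<le> (norm S + 1) * norm ((A - a *\<^sub>R id_blinfun) x)" for x
  proof -
    have "norm x \<le> norm S * norm ((A - a *\<^sub>R id_blinfun) x)"
      using norm_blinfun[of S "A x - a *\<^sub>R x"] S[of x]
      by (simp add: scaleC_of_real blinfun.diff_left blinfun.scaleR_left)
    then show ?thesis by (smt (verit) mult_right_mono norm_ge_zero)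
  qed
  then have "bounded_below_op (A - a *\<^sub>R id_blinfun)"
    unfolding bounded_below_op_def
    by (intro exI[of _ "1 / (norm S + 1)"]) (auto simp: divide_le_eq mult.commute add_nonneg_pos)
  with assms show False ..
qed

text \<open>The bound over the spectrum itself, matching the uniform limit in \<open>op_fun\<close>;
  it serves uniqueness of the limit operator.\<close>

lemma norm_op_poly_le_spectrum:
  assumes "positive_op A" "0 \<le> c" "\<And>a. complex_of_real a \<in> op_spectrum A \<Longrightarrow> \<bar>poly p a\<bar> \<le> c"
  shows "norm (op_poly p A) \<le> c"
  using assms by (intro norm_op_poly_le_approximate_spectrum) (auto simp: positive_op_def not_bounded_below_imp_spectrum)

text \<open>The bound over an explicit interval, where polynomial approximation is available; it
  serves existence and norm estimates.\<close>

lemma norm_op_poly_le: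
  assumes "positive_op A" "0 \<le> c" "\<And>a. a \<in> {0..norm A} \<Longrightarrow> \<bar>poly p a\<bar> \<le> c"
  shows "norm (op_poly p A) \<le> c"
  using assms not_bounded_below_imp_interval[OF assms(1)]
  by (intro norm_op_poly_le_approximate_spectrum) (auto simp: positive_op_def)

text \<open>Two approximating sequences differ by polynomials that are uniformly small on the
  spectrum, so their operators have the same limit. The symmetric interval is chosen because
  \<open>spectrum_norm_le\<close> directly places the real spectrum in it.\<close>

lemma op_fun_eqI:
  fixes A :: "'a::chilbert_space \<Rightarrow>\<^sub>L 'a"
  assumes A: "positive_op A"
    and p: "uniform_limit {-norm A..norm A} (\<lambda>n. poly (p n)) f sequentially"
    and B: "(\<lambda>n. op_poly (p n) A) \<longlonglongrightarrow> B"
  shows "op_fun f A = B"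
  unfolding op_fun_def
proof (rule the_equality)
  let ?S = "{x. complex_of_real x \<in> op_spectrum A}"
  have "\<bar>x\<bar> \<le> norm A" if "x \<in> ?S" for x
    using spectrum_norm_le[of "complex_of_real x" A] that by simp
  then have "?S \<subseteq> {-norm A..norm A}" by (force simp: abs_le_iff)
  with p have pS: "uniform_limit ?S (\<lambda>n. poly (p n)) f sequentially"
    by (rule uniform_limit_on_subset)
  with B show "\<exists>p. uniform_limit ?S (\<lambda>n. poly (p n)) f sequentially \<and> (\<lambda>n. op_poly (p n) A) \<longlonglongrightarrow> B"
    by blast
  fix C assume "\<exists>p. uniform_limit ?S (\<lambda>n. poly (p n)) f sequentially \<and> (\<lambda>n. op_poly (p n) A) \<longlonglongrightarrow> C"
  then obtain q where q: "uniform_limit ?S (\<lambda>n. poly (q n)) f sequentially" "(\<lambda>n. op_poly (q n) A) \<longlonglongrightarrow> C"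
    by blast
  have "(\<lambda>n. op_poly (q n - p n) A) \<longlonglongrightarrow> 0"
  proof (rule metric_LIMSEQ_I)
    fix e :: real assume e: "e > 0"
    have "uniform_limit ?S (\<lambda>n x. poly (q n) x - poly (p n) x) (\<lambda>x. f x - f x) sequentially"
      by (intro uniform_limit_minus q pS)
    then have "\<forall>\<^sub>F n in sequentially. \<forall>x\<in>?S. dist (poly (q n) x - poly (p n) x) (f x - f x) < e / 2"
      by (rule uniform_limitD) (use e in simp)
    then have "\<forall>\<^sub>F n in sequentially. norm (op_poly (q n - p n) A) < e"
    proof eventually_elim
      case (elim n)
      have "norm (op_poly (q n - p n) A) \<le> e / 2"
        by (rule norm_op_poly_le_spectrum[OF A]) (use e elim in \<open>auto intro: less_imp_le\<close>)
      with e show ?case by simp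
    qed
    then show "\<exists>N. \<forall>n\<ge>N. dist (op_poly (q n - p n) A) 0 < e" by (simp add: eventually_sequentially)
  qed
  moreover have "(\<lambda>n. op_poly (q n - p n) A) \<longlonglongrightarrow> C - B"
    unfolding op_poly_diff by (intro tendsto_diff q B)
  ultimately show "C = B" using LIMSEQ_unique by fastforce
qed

lemma real_poly_approximation:
  fixes f :: "real \<Rightarrow> real"
  assumes "continuous_on {a..b} f"
  obtains p where "uniform_limit {a..b} (\<lambda>n. poly (p n)) f sequentially"
proof -
  have "\<exists>p. \<forall>x\<in>{a..b}. \<bar>f x - poly p x\<bar> < inverse (real (Suc n))" for n
  proof -
    obtain g where g: "real_polynomial_function g" "\<And>x. x \<in> {a..b} \<Longrightarrow> norm (f x - g x) < inverse (real (Suc n))"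
      using Stone_Weierstrass_polynomial_function[OF compact_Icc assms, of "inverse (real (Suc n))"]
      by (auto simp: real_polynomial_function_eq)
    then obtain c m where "g = (\<lambda>x. \<Sum>i\<le>m. c i * x ^ i)" by (auto simp: real_polynomial_function_iff_sum)
    then have "poly (\<Sum>i\<le>m. monom (c i) i) x = g x" for x by (simp add: poly_sum poly_monom)
    then show ?thesis using g(2) by (intro exI[of _ "\<Sum>i\<le>m. monom (c i) i"]) auto
  qed
  then obtain p where p: "\<And>n x. x \<in> {a..b} \<Longrightarrow> \<bar>f x - poly (p n) x\<bar> < inverse (real (Suc n))" by metis
  have "uniform_limit {a..b} (\<lambda>n. poly (p n)) f sequentially"
  proof (rule uniform_limitI)
    fix e :: real assume "e > 0"
    then have "\<forall>\<^sub>F n in sequentially. inverse (real (Suc n)) < e"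
      by (intro order_tendstoD[OF LIMSEQ_inverse_real_of_nat])
    then show "\<forall>\<^sub>F n in sequentially. \<forall>x\<in>{a..b}. dist (poly (p n) x) (f x) < e"
    proof eventually_elim
      case (elim n)
      show ?case
      proof
        fix x assume "x \<in> {a..b}"
        from p[OF this, of n] elim show "dist (poly (p n) x) (f x) < e"
          by (simp add: dist_real_def abs_minus_commute)
      qed
    qed
  qed
  then show thesis by (rule that)
qed

text \<open>Existence for the \<open>THE\<close> in \<open>op_fun\<close>: uniformly close
  polynomials give operators close in norm, and completeness supplies the limit.\<close>

lemma op_fun_approx:
  fixes A :: "'a::chilbert_space \<Rightarrow>\<^sub>L 'a"
  assumes A: "positive_op A" and f: "continuous_on UNIV f"
  obtains p where "uniform_limit {-norm A..norm A} (\<lambda>n. poly (p n)) f sequentially"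
    "(\<lambda>n. op_poly (p n) A) \<longlonglongrightarrow> op_fun f A"
proof -
  obtain p where p: "uniform_limit {-norm A..norm A} (\<lambda>n. poly (p n)) f sequentially"
    using real_poly_approximation continuous_on_subset[OF f] by blast
  have "Cauchy (\<lambda>n. op_poly (p n) A)"
  proof (rule metric_CauchyI)
    fix e :: real assume e: "e > 0"
    from e have "e / 4 > 0" by simp
    from uniform_limitD[OF p this]
    obtain N where N: "\<And>n x. n \<ge> N \<Longrightarrow> x \<in> {-norm A..norm A} \<Longrightarrow> \<bar>poly (p n) x - f x\<bar> < e / 4"
      unfolding eventually_sequentially dist_real_def by blast
    have "dist (op_poly (p m) A) (op_poly (p n) A) < e" if "m \<ge> N" "n \<ge> N" for m n
    proof -
      have "norm (op_poly (p m - p n) A) \<le> e / 2"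
      proof (rule norm_op_poly_le[OF A])
        fix a assume "a \<in> {0..norm A}"
        then have "a \<in> {-norm A..norm A}" by auto
        from N[OF that(1) this] N[OF that(2) this]
        show "\<bar>poly (p m - p n) a\<bar> \<le> e / 2" unfolding poly_diff by linarith
      qed (use e in simp)
      then show ?thesis using e by (simp add: dist_norm op_poly_diff)
    qed
    then show "\<exists>M. \<forall>m\<ge>M. \<forall>n\<ge>M. dist (op_poly (p m) A) (op_poly (p n) A) < e" by blast
  qed
  then obtain B where "(\<lambda>n. op_poly (p n) A) \<longlonglongrightarrow> B" using Cauchy_convergent_iff convergent_def by blast
  with op_fun_eqI[OF A p this] p show thesis by (intro that[of p]) auto
qed

lemma op_fun_diff:
  assumes A: "positive_op A" and f: "continuous_on UNIV f" "continuous_on UNIV g"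
  shows "op_fun (\<lambda>x. f x - g x) A = op_fun f A - op_fun g A"
proof -
  obtain p where p: "uniform_limit {-norm A..norm A} (\<lambda>n. poly (p n)) f sequentially"
    "(\<lambda>n. op_poly (p n) A) \<longlonglongrightarrow> op_fun f A" using op_fun_approx[OF A f(1)] by blast
  obtain q where q: "uniform_limit {-norm A..norm A} (\<lambda>n. poly (q n)) g sequentially"
    "(\<lambda>n. op_poly (q n) A) \<longlonglongrightarrow> op_fun g A" using op_fun_approx[OF A f(2)] by blast
  show ?thesis
  proof (rule op_fun_eqI[OF A])
    show "uniform_limit {-norm A..norm A} (\<lambda>n. poly (p n - q n)) (\<lambda>x. f x - g x) sequentially"
      using uniform_limit_minus[OF p(1) q(1)] by (simp flip: poly_diff)
    show "(\<lambda>n. op_poly (p n - q n) A) \<longlonglongrightarrow> op_fun f A - op_fun g A"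
      unfolding op_poly_diff by (intro tendsto_diff p q)
  qed
qed

lemma op_fun_mult:
  assumes A: "positive_op A" and f: "continuous_on UNIV f" "continuous_on UNIV g"
  shows "op_fun (\<lambda>x. f x * g x) A = op_fun f A o\<^sub>L op_fun g A"
proof -
  obtain p where p: "uniform_limit {-norm A..norm A} (\<lambda>n. poly (p n)) f sequentially"
    "(\<lambda>n. op_poly (p n) A) \<longlonglongrightarrow> op_fun f A" using op_fun_approx[OF A f(1)] by blast
  obtain q where q: "uniform_limit {-norm A..norm A} (\<lambda>n. poly (q n)) g sequentially"
    "(\<lambda>n. op_poly (q n) A) \<longlonglongrightarrow> op_fun g A" using op_fun_approx[OF A f(2)] by blast
  have bdd: "bounded (h ` {-norm A..norm A})" if "continuous_on UNIV h" for h :: "real \<Rightarrow> real"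
    using that by (meson compact_Icc compact_continuous_image compact_imp_bounded continuous_on_subset subset_UNIV)
  show ?thesis
  proof (rule op_fun_eqI[OF A])
    show "uniform_limit {-norm A..norm A} (\<lambda>n. poly (p n * q n)) (\<lambda>x. f x * g x) sequentially"
      using uniform_lim_mult[OF p(1) q(1) bdd[OF f(1)] bdd[OF f(2)]] by (simp flip: poly_mult)
    show "(\<lambda>n. op_poly (p n * q n) A) \<longlonglongrightarrow> (op_fun f A o\<^sub>L op_fun g A)"
      unfolding op_poly_mult by (intro blinfun_compose.tendsto p q)
  qed
qed

lemma op_fun_poly:
  assumes A: "positive_op A"
  shows "op_fun (poly p) A = op_poly p A"
  by (rule op_fun_eqI[OF A, of "\<lambda>_. p"]) (auto intro: uniform_limit_const)

lemma op_fun_ident: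
  assumes "positive_op A"
  shows "op_fun (\<lambda>x. x) A = A"
proof -
  have "poly [:0, 1:] = (\<lambda>x :: real. x)" by auto
  with op_fun_poly[OF assms, of "[:0, 1:]"] show ?thesis by (simp only: op_poly_X)
qed

lemma norm_op_fun_le:
  assumes A: "positive_op A" and f: "continuous_on UNIV f"
    and c: "0 \<le> c" "\<And>x. 0 \<le> x \<Longrightarrow> x \<le> norm A \<Longrightarrow> \<bar>f x\<bar> \<le> c"
  shows "norm (op_fun f A) \<le> c"
proof (rule field_le_epsilon)
  fix e :: real assume e: "e > 0"
  obtain p where p: "uniform_limit {-norm A..norm A} (\<lambda>n. poly (p n)) f sequentially"
    "(\<lambda>n. op_poly (p n) A) \<longlonglongrightarrow> op_fun f A" using op_fun_approx[OF A f] by blast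
  from uniform_limitD[OF p(1) e]
  have "\<forall>\<^sub>F n in sequentially. norm (op_poly (p n) A) \<le> c + e"
  proof eventually_elim
    case (elim n)
    show ?case
    proof (rule norm_op_poly_le[OF A])
      fix a assume a: "a \<in> {0..norm A}"
      then have "a \<in> {-norm A..norm A}" by auto
      with elim have "\<bar>poly (p n) a - f a\<bar> < e" by (simp add: dist_real_def)
      with c(2)[of a] a show "\<bar>poly (p n) a\<bar> \<le> c + e" by auto
    qed (use c e in simp)
  qed
  then show "norm (op_fun f A) \<le> c + e"
    by (intro tendsto_upperbound[OF tendsto_norm[OF p(2)]]) auto
qed

text \<open>The norm bound looks only at nonnegative arguments, so the values that
  \<open>sqrt\<close> or \<open>powr\<close> take at negative ones do not matter.\<close>

lemma op_fun_cong:
  assumes A: "positive_op A" and f: "continuous_on UNIV f" "continuous_on UNIV g"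
    and eq: "\<And>x. 0 \<le> x \<Longrightarrow> f x = g x"
  shows "op_fun f A = op_fun g A"
proof -
  have "norm (op_fun (\<lambda>x. f x - g x) A) \<le> 0"
    by (rule norm_op_fun_le[OF A]) (auto simp: eq intro!: continuous_intros f)
  then show ?thesis by (simp add: op_fun_diff[OF A f])
qed

lemma selfadjoint_op_fun:
  assumes A: "positive_op A" and f: "continuous_on UNIV f"
  shows "selfadjoint_op (op_fun f A)"
  unfolding selfadjoint_op_def
proof (intro allI)
  fix x y
  obtain p where p: "(\<lambda>n. op_poly (p n) A) \<longlonglongrightarrow> op_fun f A" using op_fun_approx[OF A f] by blast
  have "(\<lambda>n. op_poly (p n) A x \<bullet> y) \<longlonglongrightarrow> op_fun f A x \<bullet> y"
    by (intro tendsto_intros p)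
  moreover have "(\<lambda>n. x \<bullet> op_poly (p n) A y) \<longlonglongrightarrow> x \<bullet> op_fun f A y"
    by (intro tendsto_intros p)
  moreover have "op_poly (p n) A x \<bullet> y = x \<bullet> op_poly (p n) A y" for n
    using A selfadjoint_op_poly[of A "p n"] by (simp add: positive_op_def selfadjoint_op_def)
  ultimately show "op_fun f A x \<bullet> y = x \<bullet> op_fun f A y" using LIMSEQ_unique by auto
qed

lemma clinear_op_fun:
  assumes A: "positive_op A" and f: "continuous_on UNIV f"
  shows "clinear_op (op_fun f A)"
proof -
  obtain p where p: "(\<lambda>n. op_poly (p n) A) \<longlonglongrightarrow> op_fun f A" using op_fun_approx[OF A f] by blast
  show ?thesis
  proof (rule clinear_op_tendsto)
    show "clinear_op (op_poly (p n) A)" for n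
      using A by (auto simp: positive_op_def intro: clinear_op_poly)
    show "(\<lambda>n. op_poly (p n) A x) \<longlonglongrightarrow> op_fun f A x" for x
      by (intro tendsto_intros p)
  qed
qed

text \<open>The operator is the square of the self-adjoint
  \<open>op_fun (\<lambda>x. sqrt (f x)) A\<close>. Replacing \<open>f\<close> by
  \<open>sqrt f * sqrt f\<close> can change it only at negative arguments, which
  \<open>op_fun_cong\<close> ignores.\<close>

lemma positive_op_fun:
  assumes A: "positive_op A" and f: "continuous_on UNIV f" "\<And>x. 0 \<le> x \<Longrightarrow> 0 \<le> f x"
  shows "positive_op (op_fun f A)"
  unfolding positive_op_def
proof (intro conjI allI clinear_op_fun selfadjoint_op_fun A f)
  fix x
  define S where "S = op_fun (\<lambda>x. sqrt (f x)) A"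
  have cont: "continuous_on UNIV (\<lambda>x. sqrt (f x))" by (intro continuous_intros f)
  have "op_fun f A = op_fun (\<lambda>x. sqrt (f x) * sqrt (f x)) A"
    by (rule op_fun_cong[OF A f(1)]) (auto intro!: continuous_intros cont f simp: f)
  also have "\<dots> = S o\<^sub>L S" unfolding S_def by (rule op_fun_mult[OF A cont cont])
  finally have "op_fun f A x \<bullet> x = S x \<bullet> S x"
    using selfadjoint_op_fun[OF A cont] by (simp add: S_def selfadjoint_op_def)
  then show "0 \<le> op_fun f A x \<bullet> x" by simp
qed

section \<open>A Heinz inequality\<close>

lemma norm_adjoint_le:
  assumes adj: "\<And>x y. blinfun_apply Y x \<bullet> y = x \<bullet> blinfun_apply Z y"
  shows "norm Z \<le> norm Y"
proof (rule norm_blinfun_bound)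
  fix y
  show "norm (Z y) \<le> norm Y * norm y"
  proof (cases "Z y = 0")
    case False
    have "norm (Z y) * norm (Z y) = Y (Z y) \<bullet> y"
      by (simp add: adj power2_norm_eq_inner flip: power2_eq_square)
    also have "\<dots> \<le> norm (Y (Z y)) * norm y" by (rule norm_cauchy_schwarz)
    also have "\<dots> \<le> (norm Y * norm (Z y)) * norm y" by (intro mult_right_mono norm_blinfun) auto
    finally show ?thesis using False by (simp add: mult.commute mult.left_commute)
  qed simp
qed simp

lemma norm_power2_le_adjoint_compose:
  assumes adj: "\<And>x y. blinfun_apply Y x \<bullet> y = x \<bullet> blinfun_apply Z y"
  shows "(norm Y)\<^sup>2 \<le> norm (Z o\<^sub>L Y)"
proof -
  have "norm Y \<le> sqrt (norm (Z o\<^sub>L Y))"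
  proof (rule norm_blinfun_bound)
    fix x
    have "(norm (Y x))\<^sup>2 = x \<bullet> (Z o\<^sub>L Y) x" by (simp add: power2_norm_eq_inner adj)
    also have "\<dots> \<le> norm x * norm ((Z o\<^sub>L Y) x)" by (rule norm_cauchy_schwarz)
    also have "\<dots> \<le> norm x * (norm (Z o\<^sub>L Y) * norm x)" by (intro mult_left_mono norm_blinfun) auto
    also have "\<dots> = (sqrt (norm (Z o\<^sub>L Y)) * norm x)\<^sup>2" by (simp add: power_mult_distrib power2_eq_square)
    finally show "norm (Y x) \<le> sqrt (norm (Z o\<^sub>L Y)) * norm x" by (rule power2_le_imp_le) simp
  qed simp
  then have "(norm Y)\<^sup>2 \<le> (sqrt (norm (Z o\<^sub>L Y)))\<^sup>2" by (intro power_mono) auto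
  then show ?thesis by simp
qed

section \<open>Norms of powers of self-adjoint operators\<close>

lemma selfadjoint_op_pow:
  assumes "selfadjoint_op S"
  shows "selfadjoint_op (op_pow S n)"
proof (induction n)
  case (Suc n)
  have "op_pow S (Suc n) x \<bullet> y = x \<bullet> op_pow S (Suc n) y" for x y
  proof -
    have "op_pow S (Suc n) x \<bullet> y = x \<bullet> (op_pow S n o\<^sub>L S) y"
      using assms Suc by (simp add: selfadjoint_op_def)
    then show ?thesis by (simp only: op_pow_Suc_right)
  qed
  then show ?case by (simp add: selfadjoint_op_def del: funpow.simps)
qed (simp add: selfadjoint_op_def)

lemma selfadjoint_norm_power_le:
  assumes "selfadjoint_op S"
  shows "norm S ^ (2 ^ k) \<le> norm (op_pow S (2 ^ k))"
proof (induction k)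
  case (Suc k)
  have "norm S ^ (2 ^ Suc k) = (norm S ^ (2 ^ k))\<^sup>2" by (simp flip: power_mult add: mult.commute)
  also have "\<dots> \<le> (norm (op_pow S (2 ^ k)))\<^sup>2" by (intro power_mono Suc) auto
  also have "\<dots> \<le> norm (op_pow S (2 ^ k) o\<^sub>L op_pow S (2 ^ k))"
    using selfadjoint_op_pow[OF assms] by (intro norm_power2_le_adjoint_compose) (simp add: selfadjoint_op_def)
  also have "op_pow S (2 ^ k) o\<^sub>L op_pow S (2 ^ k) = op_pow S (2 ^ Suc k)"
    by (simp only: op_pow_add[symmetric] power_Suc mult_2)
  finally show ?case .
qed simp

text \<open>For self-adjoint \<open>S\<close> the norm is recovered from the growth of the powers
  \<open>2 ^ k\<close>, so the factor \<open>C\<close> disappears in the limit.\<close>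

lemma selfadjoint_norm_le_if_powers_le:
  assumes S: "selfadjoint_op S" and g: "0 \<le> g" and le: "\<And>n. norm (op_pow S (Suc n)) \<le> C * g ^ n"
  shows "norm S \<le> g"
proof (rule ccontr)
  assume "\<not> norm S \<le> g"
  \<comment> \<open>A number strictly below \<open>norm S\<close> and at least \<open>g\<close> that
    is positive even for \<open>g = 0\<close>, so that it can be divided by.\<close>
  define h where "h = (g + norm S) / 2"
  have h: "g \<le> h" "0 < h" "h < norm S" using \<open>\<not> norm S \<le> g\<close> g by (auto simp: h_def)
  have C: "0 \<le> C" using order_trans[OF norm_ge_zero le[of 0]] by simp
  have "(norm S / h) ^ k \<le> C / norm S" for k
  proof -
    \<comment> \<open>The bound \<open>le\<close> concerns exponents \<open>Suc m\<close>, repeated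
      squaring exponents \<open>2 ^ k\<close>.\<close>
    define m where "m = (2::nat) ^ k - 1"
    have m: "2 ^ k = Suc m" "k \<le> m" unfolding m_def using less_exp[of k] by linarith+
    have "norm S * norm S ^ m \<le> norm (op_pow S (Suc m))"
      using selfadjoint_norm_power_le[OF S, of k] unfolding m(1) by (simp only: power_Suc)
    also have "\<dots> \<le> C * g ^ m" by (rule le)
    also have "\<dots> \<le> C * h ^ m" using C g h by (intro mult_left_mono power_mono) auto
    finally have "norm S * (norm S / h) ^ m \<le> C" using h by (simp add: power_divide field_simps)
    moreover have "(norm S / h) ^ k \<le> (norm S / h) ^ m" using h m by (intro power_increasing) auto
    ultimately have "norm S * (norm S / h) ^ k \<le> C" by (meson mult_left_mono norm_ge_zero order_trans)
    moreover have "0 < norm S" using h by linarith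
    ultimately show ?thesis by (simp add: pos_le_divide_eq mult.commute)
  qed
  moreover obtain k where "C / norm S < (norm S / h) ^ k" using real_arch_pow[of "norm S / h"] h by auto
  ultimately show False by (simp add: not_le[symmetric])
qed

text \<open>An elementary form of the fact that UW and WU have the same spectral radius, which for
  the self-adjoint UW is its norm: powers of UW are powers of WU, one lower, between
  \<open>U\<close> and \<open>W\<close>.\<close>

lemma selfadjoint_norm_le_commuted:
  assumes S: "selfadjoint_op (U o\<^sub>L W)"
  shows "norm (U o\<^sub>L W) \<le> norm (W o\<^sub>L U)"
proof (rule selfadjoint_norm_le_if_powers_le[OF S, where C = "norm U * norm W"])
  fix n
  have "op_pow (U o\<^sub>L W) (Suc n) = U o\<^sub>L (op_pow (W o\<^sub>L U) n o\<^sub>L W)"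
    by (induction n) (simp_all add: blinfun_compose_assoc)
  then have "norm (op_pow (U o\<^sub>L W) (Suc n)) \<le> norm U * (norm (op_pow (W o\<^sub>L U) n) * norm W)"
    by (simp del: funpow.simps) (intro norm_blinfun_compose[THEN order_trans] mult_left_mono norm_blinfun_compose norm_ge_zero)
  also have "\<dots> \<le> norm U * (norm (W o\<^sub>L U) ^ n * norm W)"
    by (intro mult_left_mono mult_right_mono norm_op_pow_le norm_ge_zero)
  finally show "norm (op_pow (U o\<^sub>L W) (Suc n)) \<le> norm U * norm W * norm (W o\<^sub>L U) ^ n" by (simp add: mult_ac)
qed simp

text \<open>Doubling the distance to the nearer end point sends \<open>t\<close> to
  \<open>2 * t\<close> or \<open>2 * t - 1\<close> and at least squares the value. Iterating gives
  \<open>r t ^ (2 ^ n) \<le> K\<close> for all \<open>n\<close>, impossible if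
  \<open>r t > 1\<close>.\<close>

lemma bounded_midpoint_convex_le_1:
  fixes r :: "real \<Rightarrow> real"
  assumes bd: "\<And>t. 0 \<le> t \<Longrightarrow> t \<le> 1 \<Longrightarrow> 0 \<le> r t \<and> r t \<le> K"
    and lower: "\<And>t. 0 \<le> t \<Longrightarrow> t \<le> 1/2 \<Longrightarrow> (r t)\<^sup>2 \<le> r (2 * t)"
    and upper: "\<And>t. 1/2 \<le> t \<Longrightarrow> t \<le> 1 \<Longrightarrow> (r t)\<^sup>2 \<le> r (2 * t - 1)"
    and t: "0 \<le> t" "t \<le> 1"
  shows "r t \<le> 1"
proof (rule ccontr)
  assume "\<not> r t \<le> 1"
  have pow: "r t ^ (2 ^ n) \<le> K" if "0 \<le> t" "t \<le> 1" for t n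
    using that
  proof (induction n arbitrary: t)
    case (Suc n)
    obtain u where u: "0 \<le> u" "u \<le> 1" "(r t)\<^sup>2 \<le> r u"
    proof (cases "t \<le> 1/2")
      case True
      then show thesis using Suc.prems lower[of t] that[of "2 * t"] by simp
    next
      case False
      then show thesis using Suc.prems upper[of t] that[of "2 * t - 1"] by simp
    qed
    have "r t ^ (2 ^ Suc n) = ((r t)\<^sup>2) ^ (2 ^ n)" by (simp add: power_mult)
    also have "\<dots> \<le> r u ^ (2 ^ n)" by (intro power_mono u) auto
    also have "\<dots> \<le> K" by (rule Suc.IH) (use u in auto)
    finally show ?case .
  qed (use bd in auto)
  obtain k where "K < r t ^ k" using real_arch_pow[of "r t"] \<open>\<not> r t \<le> 1\<close> by auto
  also have "\<dots> \<le> r t ^ (2 ^ k)" using \<open>\<not> r t \<le> 1\<close> less_exp[of k] by (intro power_increasing) auto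
  finally show False using pow[OF t, of k] by simp
qed

text \<open>Abstracts the powers \<open>A\<^sup>s\<close> of a positive operator. The bound
  \<open>B\<close> on the unit interval is what \<open>bounded_midpoint_convex_le_1\<close> uses in
  place of continuity in \<open>s\<close>.\<close>

locale selfadjoint_semigroup =
  fixes P :: "real \<Rightarrow> ('a::{real_inner,banach} \<Rightarrow>\<^sub>L 'a)" and B :: real
  assumes zero: "P 0 = id_blinfun"
    and add: "\<And>s r. 0 \<le> s \<Longrightarrow> 0 \<le> r \<Longrightarrow> P (s + r) = P s o\<^sub>L P r"
    and selfadjoint: "\<And>s. selfadjoint_op (P s)"
    and bound: "\<And>s. 0 \<le> s \<Longrightarrow> s \<le> 1 \<Longrightarrow> norm (P s) \<le> B"
begin

lemma inner_P: "P s x \<bullet> y = x \<bullet> P s y"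
  using selfadjoint by (simp add: selfadjoint_op_def)

text \<open>Let Y be the operator on the left. Its squared norm is at most the norm of the
  self-adjoint \<open>Y' o\<^sub>L Y\<close>, which starts with
  \<open>P m = P (m - d) o\<^sub>L P d\<close>. Moving \<open>P (m - d)\<close> to the far right
  turns the last factor \<open>P m\<close> into \<open>P b\<close>, and the middle
  \<open>P l o\<^sub>L P l\<close> splits as \<open>P c o\<^sub>L P a\<close>. The assumption
  \<open>d \<le> b\<close> makes \<open>m - d\<close> nonnegative.\<close>

lemma midpoint_le_aux:
  fixes X :: "'a \<Rightarrow>\<^sub>L 'a"
  assumes "0 \<le> a" "0 \<le> b" "0 \<le> c" "0 \<le> d" "d \<le> b"
  shows "(norm (P ((a + c) / 2) o\<^sub>L X o\<^sub>L P ((b + d) / 2)))\<^sup>2 \<le>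
    norm (P a o\<^sub>L X o\<^sub>L P b) * norm (P c o\<^sub>L X o\<^sub>L P d)"
proof -
  obtain X' :: "'a \<Rightarrow>\<^sub>L 'a" where X': "\<And>x y. X x \<bullet> y = x \<bullet> X' y" using adjoint_exists[of X] by blast
  define m l where "m = (b + d) / 2" and "l = (a + c) / 2"
  have ml: "0 \<le> m - d" "0 \<le> m" "0 \<le> l" using assms by (auto simp: m_def l_def)
  define Y where "Y = P l o\<^sub>L X o\<^sub>L P m"
  define Y' where "Y' = P m o\<^sub>L X' o\<^sub>L P l"
  define U W where "U = P (m - d)" and "W = (P d o\<^sub>L X' o\<^sub>L P c) o\<^sub>L (P a o\<^sub>L X o\<^sub>L P m)"
  have Y: "Y x \<bullet> y = x \<bullet> Y' y" for x y by (simp add: Y_def Y'_def inner_P X')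
  have Pm: "P m = U o\<^sub>L P d" using add[of "m - d" d] ml assms by (simp add: U_def)
  have Pl: "P l o\<^sub>L P l = P c o\<^sub>L P a"
    using add[of l l] add[of c a] ml assms by (simp add: l_def add.commute)
  have "Y' o\<^sub>L Y = P m o\<^sub>L (X' o\<^sub>L ((P l o\<^sub>L P l) o\<^sub>L (X o\<^sub>L P m)))"
    by (simp only: Y_def Y'_def blinfun_compose_assoc)
  also have "\<dots> = (U o\<^sub>L P d) o\<^sub>L (X' o\<^sub>L ((P c o\<^sub>L P a) o\<^sub>L (X o\<^sub>L P m)))"
    by (simp only: Pm Pl)
  finally have YY: "Y' o\<^sub>L Y = U o\<^sub>L W"
    by (simp only: W_def blinfun_compose_assoc)
  have "P m o\<^sub>L U = P b" using add[of m "m - d"] ml by (simp add: U_def m_def field_simps)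
  then have WU: "W o\<^sub>L U = (P d o\<^sub>L X' o\<^sub>L P c) o\<^sub>L (P a o\<^sub>L X o\<^sub>L P b)"
    unfolding W_def by (simp add: blinfun_compose_assoc)
  have "selfadjoint_op (Y' o\<^sub>L Y)"
    unfolding selfadjoint_op_def using Y by (simp add: inner_commute flip: Y)
  then have "norm (Y' o\<^sub>L Y) \<le> norm (W o\<^sub>L U)" unfolding YY by (rule selfadjoint_norm_le_commuted)
  also have "\<dots> \<le> norm (P d o\<^sub>L X' o\<^sub>L P c) * norm (P a o\<^sub>L X o\<^sub>L P b)"
    unfolding WU by (rule norm_blinfun_compose)
  also have "norm (P d o\<^sub>L X' o\<^sub>L P c) \<le> norm (P c o\<^sub>L X o\<^sub>L P d)"
    by (rule norm_adjoint_le) (simp add: inner_P X')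
  finally have "norm (Y' o\<^sub>L Y) \<le> norm (P a o\<^sub>L X o\<^sub>L P b) * norm (P c o\<^sub>L X o\<^sub>L P d)"
    by (simp add: mult_right_mono mult.commute)
  with norm_power2_le_adjoint_compose[of Y Y', OF Y] show ?thesis by (simp add: Y_def m_def l_def)
qed

lemma midpoint_le:
  fixes X :: "'a \<Rightarrow>\<^sub>L 'a"
  assumes "0 \<le> a" "0 \<le> b" "0 \<le> c" "0 \<le> d"
  shows "(norm (P ((a + c) / 2) o\<^sub>L X o\<^sub>L P ((b + d) / 2)))\<^sup>2 \<le>
    norm (P a o\<^sub>L X o\<^sub>L P b) * norm (P c o\<^sub>L X o\<^sub>L P d)"
  using midpoint_le_aux[of a b c d X] midpoint_le_aux[of c d a b X] assms
  by (cases "d \<le> b") (auto simp: add.commute mult.commute)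

text \<open>A three lines inequality. The ratio of the two sides is bounded and midpoint convex in the
  logarithmic sense, and at most 1 at the end points; this already forces it to be at most 1.\<close>

lemma interpolation:
  fixes X :: "'a \<Rightarrow>\<^sub>L 'a"
  assumes ab: "a \<in> {0..1}" "b \<in> {0..1}" "c \<in> {0..1}" "d \<in> {0..1}"
    and le: "norm (P a o\<^sub>L X o\<^sub>L P b) \<le> \<alpha>" "norm (P c o\<^sub>L X o\<^sub>L P d) \<le> \<beta>"
    and pos: "0 < \<alpha>" "0 < \<beta>" and t: "0 \<le> t" "t \<le> 1"
  shows "norm (P ((1 - t) * a + t * c) o\<^sub>L X o\<^sub>L P ((1 - t) * b + t * d)) \<le> \<alpha> powr (1 - t) * \<beta> powr t"
proof -
  define N where "N t = norm (P ((1 - t) * a + t * c) o\<^sub>L X o\<^sub>L P ((1 - t) * b + t * d))" for t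
  define D where "D t = \<alpha> powr (1 - t) * \<beta> powr t" for t
  have Dpos: "0 < D t" for t unfolding D_def using pos by simp
  have comb: "0 \<le> (1 - s) * x + s * y" "(1 - s) * x + s * y \<le> 1"
    if "0 \<le> s" "s \<le> 1" "x \<in> {0..1}" "y \<in> {0..1}" for s x y :: real
  proof -
    show "0 \<le> (1 - s) * x + s * y" using that by simp
    have "(1 - s) * x + s * y \<le> (1 - s) * 1 + s * 1"
      using that by (intro add_mono mult_left_mono) auto
    then show "(1 - s) * x + s * y \<le> 1" by simp
  qed
  have mid: "(N ((s + r) / 2))\<^sup>2 \<le> N s * N r" if "0 \<le> s" "s \<le> 1" "0 \<le> r" "r \<le> 1" for s r
  proof -
    have *: "(1 - (s + r) / 2) * x + (s + r) / 2 * y = (((1 - s) * x + s * y) + ((1 - r) * x + r * y)) / 2" for x y :: real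
      by (simp add: field_simps)
    show ?thesis unfolding N_def * by (intro midpoint_le comb that ab)
  qed
  have N0: "N 0 \<le> \<alpha>" and N1: "N 1 \<le> \<beta>" using le by (simp_all add: N_def)
  have B: "0 \<le> B" using bound[of 0] norm_ge_zero[of "P 0"] by linarith
  have N_bd: "N s \<le> B * norm X * B" if "0 \<le> s" "s \<le> 1" for s
    unfolding N_def
    by (intro norm_blinfun_compose[THEN order_trans] mult_mono bound comb that ab norm_ge_zero mult_nonneg_nonneg B order_refl)
  \<comment> \<open>\<open>m * m\<close> will be a positive lower bound for \<open>D\<close> on the
    unit interval, which makes the ratio \<open>N / D\<close> bounded.\<close>
  define m where "m = min (min \<alpha> 1) (min \<beta> 1)"
  have m: "0 < m" "m \<le> 1" "m \<le> \<alpha>" "m \<le> \<beta>" using pos by (auto simp: m_def)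
  have D_ge: "m * m \<le> D s" if "0 \<le> s" "s \<le> 1" for s
  proof -
    have "m \<le> x powr u" if "m \<le> x" "0 \<le> u" "u \<le> 1" for x u
    proof -
      have "m powr 1 \<le> m powr u" using m that by (intro powr_mono') auto
      also have "\<dots> \<le> x powr u" using m that by (intro powr_mono2) auto
      finally show ?thesis using m by simp
    qed
    then show ?thesis unfolding D_def using that m by (intro mult_mono) auto
  qed
  have "N t / D t \<le> 1"
  proof (rule bounded_midpoint_convex_le_1[where r = "\<lambda>s. N s / D s" and K = "(B * norm X * B) / (m * m)"])
    fix s :: real assume s: "0 \<le> s" "s \<le> 1"
    have "N s / D s \<le> (B * norm X * B) / (m * m)"
      using N_bd[OF s] D_ge[OF s] m B by (intro frac_le) auto
    moreover have "0 \<le> N s / D s" using Dpos[of s] by (simp add: N_def)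
    ultimately show "0 \<le> N s / D s \<and> N s / D s \<le> (B * norm X * B) / (m * m)" by simp
  next
    fix s :: real assume s: "0 \<le> s" "s \<le> 1/2"
    have "(N s)\<^sup>2 \<le> N 0 * N (2 * s)" using mid[of 0 "2 * s"] s by simp
    also have "\<dots> \<le> \<alpha> * N (2 * s)" by (intro mult_right_mono N0) (simp add: N_def)
    finally have 1: "(N s)\<^sup>2 \<le> \<alpha> * N (2 * s)" .
    \<comment> \<open>\<open>D\<close> is log-linear with value \<open>\<alpha>\<close> at 0, so it
      satisfies with equality the relation that \<open>N\<close> satisfies as an inequality.\<close>
    have "(D s)\<^sup>2 = \<alpha> * D (2 * s)"
    proof -
      have "(D s)\<^sup>2 = \<alpha> powr ((1 - s) + (1 - s)) * \<beta> powr (s + s)"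
        by (simp only: D_def power2_eq_square powr_add mult_ac)
      also have "(1 - s) + (1 - s) = 1 + (1 - 2 * s)" by simp
      also have "s + s = 2 * s" by simp
      finally show ?thesis unfolding powr_add D_def using pos by simp
    qed
    then have "(N s / D s)\<^sup>2 = (N s)\<^sup>2 / (\<alpha> * D (2 * s))" by (simp add: power_divide)
    also have "\<dots> \<le> \<alpha> * N (2 * s) / (\<alpha> * D (2 * s))"
      using 1 pos Dpos[of "2 * s"] by (intro divide_right_mono) auto
    finally show "(N s / D s)\<^sup>2 \<le> N (2 * s) / D (2 * s)" using pos by simp
  next
    fix s :: real assume s: "1/2 \<le> s" "s \<le> 1"
    have "(N s)\<^sup>2 \<le> N 1 * N (2 * s - 1)" using mid[of 1 "2 * s - 1"] s by simp
    also have "\<dots> \<le> \<beta> * N (2 * s - 1)" by (intro mult_right_mono N1) (simp add: N_def)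
    finally have 1: "(N s)\<^sup>2 \<le> \<beta> * N (2 * s - 1)" .
    have "(D s)\<^sup>2 = \<beta> * D (2 * s - 1)"
    proof -
      have "(D s)\<^sup>2 = \<alpha> powr ((1 - s) + (1 - s)) * \<beta> powr (s + s)"
        by (simp only: D_def power2_eq_square powr_add mult_ac)
      also have "(1 - s) + (1 - s) = 1 - (2 * s - 1)" by simp
      also have "s + s = 1 + (2 * s - 1)" by simp
      finally show ?thesis unfolding powr_add[of \<beta>] D_def using pos by simp
    qed
    then have "(N s / D s)\<^sup>2 = (N s)\<^sup>2 / (\<beta> * D (2 * s - 1))" by (simp add: power_divide)
    also have "\<dots> \<le> \<beta> * N (2 * s - 1) / (\<beta> * D (2 * s - 1))"
      using 1 pos Dpos[of "2 * s - 1"] by (intro divide_right_mono) auto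
    finally show "(N s / D s)\<^sup>2 \<le> N (2 * s - 1) / D (2 * s - 1)" using pos by simp
  qed (use t in auto)
  then show ?thesis using Dpos[of t] by (simp add: N_def D_def)
qed

lemma heinz_inequality:
  fixes X :: "'a \<Rightarrow>\<^sub>L 'a"
  assumes le: "norm (X o\<^sub>L P 1) \<le> \<gamma>" "norm (P 1 o\<^sub>L X) \<le> \<gamma>" and t: "0 < t" "t < 1"
  shows "norm (P t o\<^sub>L X o\<^sub>L P (1 - t)) \<le> \<gamma>"
proof (rule field_le_epsilon)
  fix e :: real assume "e > 0"
  have g: "0 \<le> \<gamma>" using le(1) norm_ge_zero order_trans by blast
  \<comment> \<open>The slack \<open>e\<close> makes the two bounds positive, as
    \<open>interpolation\<close> requires; \<open>\<gamma>\<close> may be 0.\<close>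
  have "norm (P ((1 - t) * 0 + t * 1) o\<^sub>L X o\<^sub>L P ((1 - t) * 1 + t * 0)) \<le> (\<gamma> + e) powr (1 - t) * (\<gamma> + e) powr t"
    using le t g \<open>e > 0\<close> by (intro interpolation) (auto simp: zero)
  also have "\<dots> = \<gamma> + e" using g \<open>e > 0\<close> by (simp flip: powr_add)
  finally show "norm (P t o\<^sub>L X o\<^sub>L P (1 - t)) \<le> \<gamma> + e" by simp
qed

text \<open>Interpolates between the exponent pairs \<open>(0, 1)\<close> (or \<open>(1, 0)\<close>) and \<open>(1/2, 1/2)\<close>,
  where the latter is the midpoint of \<open>(0, 0)\<close> and \<open>(1, 1)\<close>.\<close>

lemma heinz_inequality_diagonal:
  fixes X :: "'a \<Rightarrow>\<^sub>L 'a"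
  assumes le: "norm (X o\<^sub>L P 1) \<le> \<alpha>" "norm (P 1 o\<^sub>L X) \<le> \<alpha>"
    and le': "norm X \<le> \<delta>" "norm (P 1 o\<^sub>L X o\<^sub>L P 1) \<le> \<epsilon>"
    and pos: "0 < \<alpha>" "0 < \<delta>" "0 < \<epsilon>" and t: "0 < t" "t < 1"
  shows "norm (P t o\<^sub>L X o\<^sub>L P (1 - t)) \<le> \<alpha> powr (1 - 2 * min t (1 - t)) * (\<delta> * \<epsilon>) powr (min t (1 - t))"
proof -
  have "(norm (P (1/2) o\<^sub>L X o\<^sub>L P (1/2)))\<^sup>2 \<le> norm X * norm (P 1 o\<^sub>L X o\<^sub>L P 1)"
    using midpoint_le[of 0 0 1 1 X] by (simp add: zero)
  also have "\<dots> \<le> \<delta> * \<epsilon>" using le' pos by (intro mult_mono) auto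
  finally have half: "norm (P (1/2) o\<^sub>L X o\<^sub>L P (1/2)) \<le> (\<delta> * \<epsilon>) powr (1/2)"
    by (simp add: real_le_rsqrt powr_half_sqrt less_imp_le pos)
  show ?thesis
  proof (cases "t \<le> 1/2")
    case True
    have "norm (P ((1 - 2 * t) * 0 + (2 * t) * (1/2)) o\<^sub>L X o\<^sub>L P ((1 - 2 * t) * 1 + (2 * t) * (1/2)))
      \<le> \<alpha> powr (1 - 2 * t) * ((\<delta> * \<epsilon>) powr (1/2)) powr (2 * t)"
      using le half pos t True by (intro interpolation) (auto simp: zero)
    moreover have "(1 - 2 * t) * 1 + (2 * t) * (1/2) = 1 - t" "(1 - 2 * t) * 0 + (2 * t) * (1/2) = t" "min t (1 - t) = t"
      using True by simp_all
    ultimately show ?thesis by (simp add: powr_powr)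
  next
    case False
    define u where "u = 1 - t"
    have e: "(1 - 2 * u) * 1 + (2 * u) * (1/2) = t" "(1 - 2 * u) * 0 + (2 * u) * (1/2) = u"
      "1/2 * (2 * u) = u" "min t (1 - t) = u"
      using False by (simp_all add: u_def field_simps)
    have "norm (P ((1 - 2 * u) * 1 + (2 * u) * (1/2)) o\<^sub>L X o\<^sub>L P ((1 - 2 * u) * 0 + (2 * u) * (1/2)))
      \<le> \<alpha> powr (1 - 2 * u) * ((\<delta> * \<epsilon>) powr (1/2)) powr (2 * u)"
      using le half pos t False by (intro interpolation) (auto simp: zero u_def)
    then show ?thesis unfolding e powr_powr by (simp only: u_def)
  qed
qed

end

section \<open>Polar decomposition\<close>

context
  fixes T :: "'a::chilbert_space \<Rightarrow>\<^sub>L 'a"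
  assumes T: "clinear_op T"
begin

lemma positive_op_adjoint_compose: "positive_op (op_adjoint T o\<^sub>L T)"
proof -
  have adj: "op_adjoint T (T x) \<bullet> y = T x \<bullet> T y" for x y
    using inner_adjoint[OF T, of y "T x"] by (simp add: inner_commute)
  show ?thesis
    unfolding positive_op_def selfadjoint_op_def
    by (simp add: adj T clinear_op_compose clinear_op_adjoint flip: inner_adjoint[OF T])
qed

lemma positive_op_abs: "positive_op (op_abs T)"
  unfolding op_abs_def by (intro positive_op_fun positive_op_adjoint_compose continuous_intros) simp

lemma inner_op_abs: "op_abs T x \<bullet> y = x \<bullet> op_abs T y"
  using positive_op_abs by (auto simp: positive_op_def selfadjoint_op_def)

lemma op_abs_square: "op_abs T o\<^sub>L op_abs T = op_adjoint T o\<^sub>L T"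
proof -
  have "op_abs T o\<^sub>L op_abs T = op_fun (\<lambda>x. sqrt x * sqrt x) (op_adjoint T o\<^sub>L T)"
    unfolding op_abs_def by (intro op_fun_mult[symmetric] positive_op_adjoint_compose continuous_intros)
  also have "\<dots> = op_fun (\<lambda>x. x) (op_adjoint T o\<^sub>L T)"
    by (intro op_fun_cong positive_op_adjoint_compose continuous_intros) simp
  also have "\<dots> = op_adjoint T o\<^sub>L T" by (rule op_fun_ident[OF positive_op_adjoint_compose])
  finally show ?thesis .
qed

lemma norm_op_abs_apply: "norm (op_abs T x) = norm (T x)"
proof -
  have "op_abs T x \<bullet> op_abs T x = x \<bullet> (op_abs T o\<^sub>L op_abs T) x"
    by (simp add: inner_op_abs)
  also have "\<dots> = T x \<bullet> T x" unfolding op_abs_square by (simp add: inner_adjoint[OF T])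
  finally show ?thesis by (simp add: norm_eq_sqrt_inner)
qed

text \<open>Positivity of \<open>k - k^2\<close>. It turns convergence of quadratic forms into norm
  convergence of vectors.\<close>

lemma op_fun_contraction:
  fixes A :: "'a \<Rightarrow>\<^sub>L 'a"
  assumes A: "positive_op A" and k: "continuous_on UNIV k" "\<And>x. 0 \<le> x \<Longrightarrow> 0 \<le> k x \<and> k x \<le> 1"
  shows "(norm (op_fun k A x))\<^sup>2 \<le> op_fun k A x \<bullet> x"
proof -
  have "positive_op (op_fun (\<lambda>x. k x - k x * k x) A)"
    using k by (intro positive_op_fun A continuous_intros) (auto simp: mult_left_le)
  moreover have "op_fun (\<lambda>x. k x - k x * k x) A = op_fun k A - (op_fun k A o\<^sub>L op_fun k A)"
    using k(1) by (simp add: op_fun_diff[OF A] op_fun_mult[OF A] continuous_intros)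
  ultimately have "0 \<le> (op_fun k A - (op_fun k A o\<^sub>L op_fun k A)) x \<bullet> x" by (simp add: positive_op_def)
  then show ?thesis
    using selfadjoint_op_fun[OF A k(1)]
    by (simp add: selfadjoint_op_def blinfun.diff_left inner_diff_left power2_norm_eq_inner)
qed

text \<open>The polar part is the strong limit of \<open>T (|T| + \<epsilon>)\<^sup>-\<^sup>1\<close> as \<open>\<epsilon>\<close> tends to 0; the operators
  \<open>|T| (|T| + \<epsilon>)\<^sup>-\<^sup>1\<close> increase to the projection onto the orthogonal complement of the kernel.\<close>

lemma polar_decomposition:
  shows polar_isometry_partial_isometry: "partial_isometry (polar_isometry T)"
    and norm_polar_isometry_le: "norm (polar_isometry T) \<le> 1"
    and polar_isometry_compose_abs: "polar_isometry T o\<^sub>L op_abs T = T"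
proof -
  define A where "A = op_abs T"
  have A: "positive_op A" unfolding A_def by (rule positive_op_abs)
  have A_self: "A x \<bullet> y = x \<bullet> A y" for x y unfolding A_def by (rule inner_op_abs)
  have norm_A: "norm (A x) = norm (T x)" for x unfolding A_def by (rule norm_op_abs_apply)
  \<comment> \<open>The role of \<open>\<epsilon>\<close> is played by
    \<open>inverse (real (Suc n))\<close>; the absolute value makes \<open>g n\<close> continuous on
    the whole line.\<close>
  define g where "g n x = 1 / (\<bar>x\<bar> + inverse (real (Suc n)))" for n :: nat and x :: real
  define h where "h n x = x * g n x" for n x
  have den: "0 < \<bar>x\<bar> + inverse (real (Suc n))" for x n by (simp add: add_nonneg_pos)
  have g_cont: "continuous_on UNIV (g n)" for n
  proof -
    have "\<bar>x\<bar> + inverse (real (Suc n)) \<noteq> 0" for x using den[of x n] by linarith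
    then show ?thesis unfolding g_def by (intro continuous_intros) blast
  qed
  have h_cont: "continuous_on UNIV (h n)" for n unfolding h_def by (intro continuous_intros g_cont)
  have h01: "0 \<le> h n x \<and> h n x \<le> 1" if "0 \<le> x" for n x
    using that den[of x n] by (simp add: h_def g_def divide_le_eq)
  have h_mono: "h m x \<le> h n x" if "m \<le> n" "0 \<le> x" for m n x
  proof -
    have "inverse (real (Suc n)) \<le> inverse (real (Suc m))" using that by (intro le_imp_inverse_le) auto
    then have "1 / (\<bar>x\<bar> + inverse (real (Suc m))) \<le> 1 / (\<bar>x\<bar> + inverse (real (Suc n)))"
      using den by (intro divide_left_mono mult_pos_pos) auto
    then show ?thesis unfolding h_def g_def using that(2) by (rule mult_left_mono)
  qed
  define G H where "G n = op_fun (g n) A" and "H n = op_fun (h n) A" for n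
  have HAG: "H n = A o\<^sub>L G n" for n
    unfolding H_def G_def h_def by (subst op_fun_mult[OF A]) (auto intro: continuous_intros g_cont simp: op_fun_ident[OF A])
  have "H n = op_fun (\<lambda>x. g n x * x) A" for n unfolding H_def h_def by (simp add: mult.commute)
  then have HGA: "H n = G n o\<^sub>L A" for n
    unfolding G_def by (subst (asm) op_fun_mult[OF A]) (auto intro: continuous_intros g_cont simp: op_fun_ident[OF A])
  have H_self: "H n x \<bullet> y = x \<bullet> H n y" for n x y
    using selfadjoint_op_fun[OF A h_cont] by (simp add: H_def selfadjoint_op_def)
  have "norm (H n) \<le> 1" for n
    unfolding H_def using h01 by (intro norm_op_fun_le A h_cont) auto
  then have H_le: "norm (H n x) \<le> norm x" for n x
    using norm_blinfun[of "H n" x] mult_right_mono[of "norm (H n)" 1 "norm x"] by fastforce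
  have H_diff: "(norm (H n x - H m x))\<^sup>2 \<le> H n x \<bullet> x - H m x \<bullet> x" if "m \<le> n" for m n x
  proof -
    have "(norm (op_fun (\<lambda>x. h n x - h m x) A x))\<^sup>2 \<le> op_fun (\<lambda>x. h n x - h m x) A x \<bullet> x"
      using h_mono[OF that] h01 by (intro op_fun_contraction A continuous_intros h_cont) (smt (verit))
    then show ?thesis by (simp add: op_fun_diff[OF A h_cont h_cont] H_def blinfun.diff_left inner_diff_left)
  qed
  have H_Cauchy: "Cauchy (\<lambda>n. H n x)" for x
  proof -
    have "incseq (\<lambda>n. H n x \<bullet> x)"
    proof (rule incseq_SucI)
      show "H n x \<bullet> x \<le> H (Suc n) x \<bullet> x" for n
        using H_diff[of n "Suc n" x] zero_le_power2[of "norm (H (Suc n) x - H n x)"] by linarith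
    qed
    moreover have "H n x \<bullet> x \<le> norm x * norm x" for n
      using norm_cauchy_schwarz[of "H n x" x] H_le[of n x] by (meson mult_right_mono norm_ge_zero order_trans)
    ultimately have "convergent (\<lambda>n. H n x \<bullet> x)" using incseq_convergent convergent_def by metis
    then have C: "Cauchy (\<lambda>n. H n x \<bullet> x)" by (rule convergent_Cauchy)
    show ?thesis
    proof (rule CauchyI')
      fix e :: real assume e: "0 < e"
      then obtain M where M: "\<forall>m\<ge>M. \<forall>n\<ge>M. dist (H m x \<bullet> x) (H n x \<bullet> x) < e\<^sup>2"
        using metric_CauchyD[OF C, of "e\<^sup>2"] by auto
      have "norm (H m x - H n x) < e" if "M \<le> m" "m < n" for m n
      proof (rule power2_less_imp_less)
        have "(norm (H m x - H n x))\<^sup>2 \<le> H n x \<bullet> x - H m x \<bullet> x"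
          using H_diff[of m n x] that by (simp add: norm_minus_commute)
        also have "\<dots> \<le> dist (H m x \<bullet> x) (H n x \<bullet> x)" by (simp add: dist_real_def)
        also have "\<dots> < e\<^sup>2" using M that by simp
        finally show "(norm (H m x - H n x))\<^sup>2 < e\<^sup>2" .
      qed (use e in simp)
      then show "\<exists>M. \<forall>m\<ge>M. \<forall>n>m. dist (H m x) (H n x) < e"
        unfolding dist_norm by blast
    qed
  qed
  then have "\<exists>y. (\<lambda>n. H n x) \<longlonglongrightarrow> y" for x using Cauchy_convergent_iff convergent_def by blast
  then obtain P where P: "\<And>x. (\<lambda>n. H n x) \<longlonglongrightarrow> P x" by metis
  \<comment> \<open>\<open>T\<close> and \<open>A\<close> have equal norms on every vector, so
    convergence of \<open>A o\<^sub>L G n\<close> transfers to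
    \<open>T o\<^sub>L G n\<close>.\<close>
  have TG_diff: "norm (T (G m x) - T (G n x)) = norm (H m x - H n x)" for m n x
    using norm_A[of "G m x - G n x"] by (simp add: HAG blinfun.diff_right)
  have TG_norm: "norm (T (G n x)) = norm (H n x)" for n x
    using norm_A[of "G n x"] by (simp add: HAG)
  have "Cauchy (\<lambda>n. T (G n x))" for x
    using H_Cauchy[of x] unfolding Cauchy_def dist_norm TG_diff .
  then have "\<exists>y. (\<lambda>n. T (G n x)) \<longlonglongrightarrow> y" for x using Cauchy_convergent_iff convergent_def by blast
  then obtain V0 where V0: "\<And>x. (\<lambda>n. T (G n x)) \<longlonglongrightarrow> V0 x" by metis
  have V0_le: "norm (V0 x) \<le> norm x" for x
    using H_le by (intro tendsto_upperbound[OF tendsto_norm[OF V0]]) (auto simp: TG_norm)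
  have "bounded_linear V0"
  proof (rule bounded_linear_intro[where K = 1])
    show "V0 (x + y) = V0 x + V0 y" for x y
      using tendsto_add[OF V0[of x] V0[of y]] V0[of "x + y"]
      by (intro LIMSEQ_unique[OF V0[of "x + y"]]) (simp add: blinfun.add_right)
    show "V0 (r *\<^sub>R x) = r *\<^sub>R V0 x" for r x
      using tendsto_scaleR[OF tendsto_const[of r] V0[of x]]
      by (intro LIMSEQ_unique[OF V0[of "r *\<^sub>R x"]]) (simp add: blinfun.scaleR_right)
  qed (use V0_le in simp)
  define V where "V = Blinfun V0"
  have V: "(\<lambda>n. T (G n x)) \<longlonglongrightarrow> V x" for x
    using V0 by (simp add: V_def bounded_linear_Blinfun_apply \<open>bounded_linear V0\<close>)
  have V_norm1: "norm V \<le> 1"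
    by (rule norm_blinfun_bound) (use V0_le in \<open>simp_all add: V_def bounded_linear_Blinfun_apply \<open>bounded_linear V0\<close>\<close>)
  have V_norm: "norm (V x) = norm (P x)" for x
    using LIMSEQ_unique[OF tendsto_norm[OF V] tendsto_norm[OF P, of x, folded TG_norm]] .
  have V_clin: "clinear_op V"
  proof (rule clinear_op_tendsto)
    show "clinear_op (T o\<^sub>L G n)" for n
      unfolding G_def by (intro clinear_op_compose T clinear_op_fun A g_cont)
  qed (use V in simp)
  have AH: "(\<lambda>n. A (H n x)) \<longlonglongrightarrow> A x" for x
  proof -
    have "norm (A - (A o\<^sub>L H n)) \<le> inverse (real (Suc n))" for n
    proof -
      \<comment> \<open>The function equals \<open>inverse (real (Suc n)) * h n x\<close>, so the
        error tends to 0 even in operator norm.\<close>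
      have "norm (op_fun (\<lambda>x. x - x * h n x) A) \<le> inverse (real (Suc n))"
      proof (rule norm_op_fun_le[OF A])
        fix x :: real assume x: "0 \<le> x"
        have "x - x * h n x = inverse (real (Suc n)) * h n x"
          using den[of x n] x by (simp add: h_def g_def divide_simps) (simp add: algebra_simps)
        moreover have "\<bar>inverse (real (Suc n)) * h n x\<bar> \<le> inverse (real (Suc n))"
          using h01[OF x, of n] by (simp add: abs_mult mult_left_le)
        ultimately show "\<bar>x - x * h n x\<bar> \<le> inverse (real (Suc n))" by simp
      qed (auto intro!: continuous_intros h_cont)
      moreover have "op_fun (\<lambda>x. x - x * h n x) A = A - (A o\<^sub>L H n)"
        by (subst op_fun_diff[OF A]; (subst op_fun_mult[OF A])?)
           (auto intro!: continuous_intros h_cont simp: op_fun_ident[OF A] H_def)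
      ultimately show ?thesis by simp
    qed
    then have "(\<lambda>n. A - (A o\<^sub>L H n)) \<longlonglongrightarrow> 0"
      by (intro Lim_null_comparison[OF _ LIMSEQ_inverse_real_of_nat]) auto
    then have "(\<lambda>n. (A - (A o\<^sub>L H n)) x) \<longlonglongrightarrow> (0 :: 'a \<Rightarrow>\<^sub>L 'a) x"
      by (intro blinfun.tendsto tendsto_const)
    then have "(\<lambda>n. A x - A (H n x)) \<longlonglongrightarrow> 0" by (simp add: blinfun.diff_left)
    from tendsto_diff[OF tendsto_const[of "A x"] this] show ?thesis by simp
  qed
  have TH: "(\<lambda>n. T (H n x)) \<longlonglongrightarrow> T x" for x
  proof -
    have "norm (T (H n x) - T x) = norm (A (H n x) - A x)" for n
      using norm_A[of "H n x - x"] by (simp add: blinfun.diff_right)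
    then show ?thesis using AH[of x] by (simp add: tendsto_iff dist_norm)
  qed
  have VA: "V (A x) = T x" for x
  proof (rule LIMSEQ_unique[OF V])
    have "T (G n (A x)) = T (H n x)" for n by (simp add: HGA)
    then show "(\<lambda>n. T (G n (A x))) \<longlonglongrightarrow> T x" using TH by simp
  qed
  have AP: "A (x - P x) = 0" for x
    using LIMSEQ_unique[OF AH[of x] blinfun.tendsto[OF tendsto_const P]] by (simp add: blinfun.diff_right)
  have ker: "op_ker V = op_ker T"
  proof -
    have "V x = 0 \<longleftrightarrow> T x = 0" for x
    proof
      assume "V x = 0"
      then have "P x = 0" using V_norm[of x] by simp
      then have "A x = 0" using AP[of x] by simp
      then show "T x = 0" using norm_A[of x] by simp
    next
      assume "T x = 0"
      then have "A x = 0" using norm_A[of x] by simp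
      then have "T (G n x) = 0" for n using TG_norm[of n x] by (simp add: HGA blinfun.zero_right)
      then show "V x = 0" using LIMSEQ_unique[OF V[of x]] by simp
    qed
    then show ?thesis by (auto simp: op_ker_def)
  qed
  have T_zero: "T (x - P x) = 0" for x using AP[of x] norm_A[of "x - P x"] by simp
  have partial: "partial_isometry V"
    unfolding partial_isometry_def
  proof (intro conjI allI impI V_clin)
    fix x assume orth: "\<forall>y\<in>op_ker V. cinner x y = 0"
    \<comment> \<open>The component of \<open>x\<close> in the kernel. It is orthogonal to
      \<open>x\<close> by assumption and to \<open>P x\<close> through \<open>H n\<close>, hence to
      itself.\<close>
    define y where "y = x - P x"
    have y: "A y = 0" "T y = 0" unfolding y_def by (rule AP, rule T_zero)
    then have "cinner x y = 0" using orth unfolding ker by (simp add: op_ker_def)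
    then have "x \<bullet> y = 0" by (simp flip: Re_cinner)
    moreover have "P x \<bullet> y = 0"
    proof -
      have "H n x \<bullet> y = 0" for n unfolding H_self by (simp add: HGA y blinfun.zero_right)
      moreover have "(\<lambda>n. H n x \<bullet> y) \<longlonglongrightarrow> P x \<bullet> y" by (intro tendsto_intros P)
      ultimately show ?thesis by (simp add: LIMSEQ_const_iff)
    qed
    ultimately have "y \<bullet> y = 0" by (simp add: y_def inner_diff_left)
    then show "norm (V x) = norm x" by (simp add: V_norm y_def)
  qed
  \<comment> \<open>\<open>W\<close> vanishes on \<open>x - P x\<close>, and on the vectors
    \<open>H n x\<close>, which tend to \<open>P x\<close>, it is fixed by
    \<open>W o\<^sub>L A = T\<close>.\<close>
  have unique: "W = V" if W: "op_ker W = op_ker T" "T = W o\<^sub>L A" for W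
  proof (rule blinfun_eqI)
    fix x
    have "W (x - P x) = 0" using W(1) T_zero[of x] by (auto simp: op_ker_def)
    then have "W x = W (P x)" by (simp add: blinfun.diff_right)
    moreover have "(\<lambda>n. W (H n x)) \<longlonglongrightarrow> W (P x)" by (intro tendsto_intros P)
    moreover have "W (H n x) = T (G n x)" for n
      using arg_cong[OF W(2), of "\<lambda>S. blinfun_apply S (G n x)"] by (simp add: HAG)
    ultimately show "W x = V x" using LIMSEQ_unique[OF V[of x]] by simp
  qed
  have VA': "V o\<^sub>L A = T" by (rule blinfun_eqI) (simp add: VA)
  have "polar_isometry T = V"
    unfolding polar_isometry_def A_def[symmetric]
  proof (rule the_equality)
    show "partial_isometry V \<and> op_ker V = op_ker T \<and> T = V o\<^sub>L A"
      using partial ker VA'[symmetric] by blast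
  qed (use unique in blast)
  then show "partial_isometry (polar_isometry T)" "norm (polar_isometry T) \<le> 1"
    "polar_isometry T o\<^sub>L op_abs T = T"
    using partial V_norm1 VA' unfolding A_def by (simp_all only:)
qed

end

section \<open>Aluthge iteration\<close>

lemma continuous_on_powr_const:
  assumes "0 < s"
  shows "continuous_on UNIV (\<lambda>x::real. x powr s)"
proof -
  \<comment> \<open>\<open>powr\<close> is even in its base because \<open>ln\<close> is even, so
    the base may be taken nonnegative.\<close>
  have eq: "(\<lambda>x::real. x powr s) = (\<lambda>x. \<bar>x\<bar> powr s)"
    by (rule ext) (simp add: powr_def abs_if ln_minus)
  show ?thesis
    by (subst eq, intro continuous_on_powr' continuous_intros) (use assms in auto)
qed

text \<open>Since \<open>0 powr 0 = 0\<close>, the exponent 0 needs its own clause for \<open>A\<^sup>0\<close> to be the identity.\<close>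

definition op_powr0 :: "('a::chilbert_space \<Rightarrow>\<^sub>L 'a) \<Rightarrow> real \<Rightarrow> ('a \<Rightarrow>\<^sub>L 'a)" where
  "op_powr0 A s = (if s \<le> 0 then id_blinfun else op_powr A s)"

lemma op_powr0_one:
  assumes A: "positive_op A"
  shows "op_powr0 A 1 = A"
proof -
  have "op_fun (\<lambda>x. x powr 1) A = op_fun (\<lambda>x. x) A"
    by (intro op_fun_cong A continuous_on_powr_const continuous_intros) auto
  then show ?thesis by (simp add: op_powr0_def op_powr_def op_fun_ident[OF A])
qed

lemma selfadjoint_semigroup_op_powr0:
  assumes A: "positive_op A"
  shows "selfadjoint_semigroup (op_powr0 A) (1 + norm A)"
proof
  show "op_powr0 A 0 = id_blinfun" by (simp add: op_powr0_def)
  show "selfadjoint_op (op_powr0 A s)" for s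
    using selfadjoint_op_fun[OF A continuous_on_powr_const, of s]
    by (auto simp: op_powr0_def op_powr_def selfadjoint_op_def)
  show "op_powr0 A (s + r) = op_powr0 A s o\<^sub>L op_powr0 A r" if "0 \<le> s" "0 \<le> r" for s r
  proof (cases "s = 0 \<or> r = 0")
    case False
    with that have "0 < s" "0 < r" by auto
    then show ?thesis
      using op_fun_mult[OF A continuous_on_powr_const[of s] continuous_on_powr_const[of r]]
      by (simp add: op_powr0_def op_powr_def powr_add)
  qed (auto simp: op_powr0_def)
  show "norm (op_powr0 A s) \<le> 1 + norm A" if "0 \<le> s" "s \<le> 1" for s
  proof (cases "s = 0")
    case True
    have "norm (id_blinfun :: 'a \<Rightarrow>\<^sub>L 'a) \<le> 1 + norm A"
      using norm_blinfun_id_le by (rule order_trans) simp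
    with True show ?thesis by (simp add: op_powr0_def)
  next
    case False
    have "norm (op_fun (\<lambda>x. x powr s) A) \<le> 1 + norm A"
    proof (rule norm_op_fun_le[OF A])
      fix x assume x: "0 \<le> x" "x \<le> norm A"
      have "x powr s \<le> (1 + norm A) powr s" using x that by (intro powr_mono2) auto
      also have "\<dots> \<le> (1 + norm A) powr 1" using that by (intro powr_mono) auto
      finally show "\<bar>x powr s\<bar> \<le> 1 + norm A" using x by simp
    qed (use False that in \<open>auto intro: continuous_on_powr_const\<close>)
    with False that show ?thesis by (simp add: op_powr0_def op_powr_def)
  qed
qed

lemma clinear_op_powr:
  assumes "positive_op A" "0 < s"
  shows "clinear_op (op_powr A s)"
  unfolding op_powr_def using assms by (intro clinear_op_fun continuous_on_powr_const)

context
  fixes T :: "'a::chilbert_space \<Rightarrow>\<^sub>L 'a" and t :: real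
  assumes T: "clinear_op T" and t: "0 < t" "t < 1"
begin

interpretation selfadjoint_semigroup "op_powr0 (op_abs T)" "1 + norm (op_abs T)"
  by (rule selfadjoint_semigroup_op_powr0[OF positive_op_abs[OF T]])

lemma clinear_polar_isometry: "clinear_op (polar_isometry T)"
  using polar_isometry_partial_isometry[OF T] by (simp add: partial_isometry_def)

lemma clinear_aluthge: "clinear_op (aluthge t T)"
  unfolding aluthge_def
  using t by (intro clinear_op_compose clinear_polar_isometry clinear_op_powr positive_op_abs[OF T]) auto

lemma aluthge_eq:
  "aluthge t T = op_powr0 (op_abs T) t o\<^sub>L polar_isometry T o\<^sub>L op_powr0 (op_abs T) (1 - t)"
  using t by (simp add: aluthge_def op_powr0_def)

lemma op_abs_eq_powr: "op_powr0 (op_abs T) (1 - t) o\<^sub>L op_powr0 (op_abs T) t = op_abs T"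
  using add[of "1 - t" t] t op_powr0_one[OF positive_op_abs[OF T]] by simp

text \<open>\<open>T\<close> and its transform are the two products of the same factors,
  \<open>V|T|^(1-t)\<close> and \<open>|T|^t\<close>, in opposite orders.\<close>

lemma spectrum_aluthge:
  assumes "z \<in> op_spectrum T" "z \<noteq> 0"
  shows "z \<in> op_spectrum (aluthge t T)"
proof -
  let ?A = "op_powr (op_abs T)"
  have "?A (1 - t) o\<^sub>L ?A t = op_abs T"
    using op_abs_eq_powr t by (simp add: op_powr0_def)
  then have "(polar_isometry T o\<^sub>L ?A (1 - t)) o\<^sub>L ?A t = T"
    by (simp only: blinfun_compose_assoc polar_isometry_compose_abs[OF T])
  then have "z \<in> op_spectrum ((polar_isometry T o\<^sub>L ?A (1 - t)) o\<^sub>L ?A t)" by (simp only: assms(1))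
  then have "z \<in> op_spectrum (?A t o\<^sub>L (polar_isometry T o\<^sub>L ?A (1 - t)))"
  proof (rule spectrum_swap[rotated 3])
    show "clinear_op (polar_isometry T o\<^sub>L ?A (1 - t))" "clinear_op (?A t)"
      by (intro clinear_op_compose clinear_polar_isometry clinear_op_powr positive_op_abs[OF T]; use t in simp)+
  qed (rule assms(2))
  then show ?thesis by (simp add: aluthge_def blinfun_compose_assoc)
qed

text \<open>Neighbouring transforms meet in \<open>|T|^(1-t) |T|^t = |T|\<close>, and each resulting
  \<open>V|T|\<close> collapses to \<open>T\<close>.\<close>

lemma op_pow_aluthge:
  "op_pow (aluthge t T) (Suc k) =
    op_powr0 (op_abs T) t o\<^sub>L (op_pow T k o\<^sub>L polar_isometry T) o\<^sub>L op_powr0 (op_abs T) (1 - t)"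
proof (induction k)
  case (Suc k)
  let ?P = "op_powr0 (op_abs T)" and ?V = "polar_isometry T"
  have "op_pow (aluthge t T) (Suc (Suc k)) = aluthge t T o\<^sub>L op_pow (aluthge t T) (Suc k)" by simp
  also have "\<dots> = ?P t o\<^sub>L (?V o\<^sub>L (?P (1 - t) o\<^sub>L ?P t) o\<^sub>L op_pow T k o\<^sub>L ?V) o\<^sub>L ?P (1 - t)"
    unfolding Suc unfolding aluthge_eq by (simp only: blinfun_compose_assoc)
  also have "\<dots> = ?P t o\<^sub>L (op_pow T (Suc k) o\<^sub>L ?V) o\<^sub>L ?P (1 - t)"
    unfolding op_abs_eq_powr polar_isometry_compose_abs[OF T] by simp
  finally show ?case .
qed (simp add: aluthge_eq)

lemma norm_op_abs_compose: "norm (op_abs T o\<^sub>L X) = norm (T o\<^sub>L X)"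
proof (rule antisym)
  show "norm (op_abs T o\<^sub>L X) \<le> norm (T o\<^sub>L X)"
    using norm_blinfun[of "T o\<^sub>L X"] by (intro norm_blinfun_bound) (simp_all add: norm_op_abs_apply[OF T])
  show "norm (T o\<^sub>L X) \<le> norm (op_abs T o\<^sub>L X)"
    using norm_blinfun[of "op_abs T o\<^sub>L X"] by (intro norm_blinfun_bound) (simp_all add: norm_op_abs_apply[OF T])
qed

lemma norm_compose_polar_isometry_le: "norm (X o\<^sub>L polar_isometry T) \<le> norm X"
proof -
  have "norm (X o\<^sub>L polar_isometry T) \<le> norm X * norm (polar_isometry T)" by (rule norm_blinfun_compose)
  also have "\<dots> \<le> norm X * 1" by (intro mult_left_mono norm_polar_isometry_le[OF T]) simp
  finally show ?thesis by simp
qed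

text \<open>On the right, \<open>V|T|\<close> is \<open>T\<close>; on the left, \<open>|T|\<close>
  may be exchanged for \<open>T\<close> without changing the norm. The inequalities come from a
  remaining factor \<open>V\<close> of norm at most 1.\<close>

lemma norm_pow_polar_le:
  fixes k :: nat
  defines "X \<equiv> op_pow T k o\<^sub>L polar_isometry T"
  shows "norm X \<le> norm (op_pow T k)"
    and "norm (X o\<^sub>L op_powr0 (op_abs T) 1) = norm (op_pow T (Suc k))"
    and "norm (op_powr0 (op_abs T) 1 o\<^sub>L X) \<le> norm (op_pow T (Suc k))"
    and "norm (op_powr0 (op_abs T) 1 o\<^sub>L X o\<^sub>L op_powr0 (op_abs T) 1) = norm (op_pow T (Suc (Suc k)))"
proof -
  note one = op_powr0_one[OF positive_op_abs[OF T]]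
  have XA: "X o\<^sub>L op_abs T = op_pow T (Suc k)"
    unfolding X_def blinfun_compose_assoc polar_isometry_compose_abs[OF T] op_pow_Suc_right ..
  show "norm X \<le> norm (op_pow T k)" unfolding X_def by (rule norm_compose_polar_isometry_le)
  show "norm (X o\<^sub>L op_powr0 (op_abs T) 1) = norm (op_pow T (Suc k))" unfolding one XA ..
  have "norm (op_abs T o\<^sub>L X) = norm (op_pow T (Suc k) o\<^sub>L polar_isometry T)"
    unfolding norm_op_abs_compose X_def by (simp add: blinfun_compose_assoc)
  then show "norm (op_powr0 (op_abs T) 1 o\<^sub>L X) \<le> norm (op_pow T (Suc k))"
    unfolding one using norm_compose_polar_isometry_le[of "op_pow T (Suc k)"] by (simp only:)
  show "norm (op_powr0 (op_abs T) 1 o\<^sub>L X o\<^sub>L op_powr0 (op_abs T) 1) = norm (op_pow T (Suc (Suc k)))"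
    unfolding one blinfun_compose_assoc XA norm_op_abs_compose by simp
qed

lemma norm_pow_aluthge_le: "norm (op_pow (aluthge t T) (Suc k)) \<le> norm (op_pow T (Suc k))"
  unfolding op_pow_aluthge
  by (rule heinz_inequality[OF eq_refl[OF norm_pow_polar_le(2)] norm_pow_polar_le(3) t])

text \<open>The bound \<open>q\<close> replaces the norm of the highest power, which may be 0
  although the interpolation asks for positive bounds.\<close>

lemma norm_pow_aluthge_le_powr:
  assumes "0 < norm (op_pow T k)" "0 < norm (op_pow T (Suc k))"
    and "norm (op_pow T (Suc (Suc k))) \<le> q" "0 < q"
  shows "norm (op_pow (aluthge t T) (Suc k)) \<le>
    norm (op_pow T (Suc k)) powr (1 - 2 * min t (1 - t)) * (norm (op_pow T k) * q) powr (min t (1 - t))"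
proof -
  have "norm (op_powr0 (op_abs T) 1 o\<^sub>L (op_pow T k o\<^sub>L polar_isometry T) o\<^sub>L op_powr0 (op_abs T) 1) \<le> q"
    using assms(3) unfolding norm_pow_polar_le(4) .
  then show ?thesis
    unfolding op_pow_aluthge
    by (intro heinz_inequality_diagonal eq_refl[OF norm_pow_polar_le(2)] norm_pow_polar_le(1,3) assms t)
qed

end

section \<open>Limits of the norms of powers along the iteration\<close>

lemma exists_nonzero_if_infinite_dimensional:
  assumes "infinite_dimensional TYPE('a::complex_inner)"
  shows "\<exists>x::'a. x \<noteq> 0"
proof (rule ccontr)
  assume "\<nexists>x::'a. x \<noteq> 0"
  then have "UNIV = {0::'a}" by auto
  then have "complex_vector.span {} = (UNIV :: 'a set)" by (simp add: complex_vector.span_empty)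
  with assms show False unfolding infinite_dimensional_def by blast
qed

lemma norm_id_blinfun_eq_1:
  assumes "(x::'a::real_normed_vector) \<noteq> 0"
  shows "norm (id_blinfun :: 'a \<Rightarrow>\<^sub>L 'a) = 1"
  using norm_blinfun[of id_blinfun x] norm_blinfun_id_le[where 'a='a] assms by simp

context
  fixes T :: "'a::chilbert_space \<Rightarrow>\<^sub>L 'a" and t :: real
  assumes T: "clinear_op T" and t: "0 < t" "t < 1"
begin

lemma clinear_aluthge_iterate: "clinear_op ((aluthge t ^^ n) T)"
  by (induction n) (use T t in \<open>simp_all add: clinear_aluthge\<close>)

lemma aluthge_iterate_pow_convergent:
  "convergent (\<lambda>n. norm (op_pow ((aluthge t ^^ n) T) k))"
proof (cases k)
  case (Suc m)
  have dec: "decseq (\<lambda>n. norm (op_pow ((aluthge t ^^ n) T) k))"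
    unfolding Suc
  proof (rule decseq_SucI)
    show "norm (op_pow ((aluthge t ^^ Suc n) T) (Suc m)) \<le> norm (op_pow ((aluthge t ^^ n) T) (Suc m))" for n
      using norm_pow_aluthge_le[OF clinear_aluthge_iterate t] by simp
  qed
  have "\<forall>n. 0 \<le> norm (op_pow ((aluthge t ^^ n) T) k)" by simp
  from decseq_convergent[OF dec this] show ?thesis by (metis convergentI)
qed (simp add: convergent_const)

definition iterate_pow_lim :: "nat \<Rightarrow> real" where
  "iterate_pow_lim k = lim (\<lambda>n. norm (op_pow ((aluthge t ^^ n) T) k))"

lemma iterate_pow_lim: "(\<lambda>n. norm (op_pow ((aluthge t ^^ n) T) k)) \<longlonglongrightarrow> iterate_pow_lim k"
  unfolding iterate_pow_lim_def using aluthge_iterate_pow_convergent convergent_LIMSEQ_iff by blast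

lemma iterate_pow_lim_le: "iterate_pow_lim (Suc k) \<le> norm (op_pow ((aluthge t ^^ n) T) (Suc k))"
proof -
  have "decseq (\<lambda>n. norm (op_pow ((aluthge t ^^ n) T) (Suc k)))"
    by (rule decseq_SucI) (use norm_pow_aluthge_le[OF clinear_aluthge_iterate t] in simp)
  then show ?thesis using iterate_pow_lim by (rule decseq_ge)
qed

lemma iterate_pow_lim_nonneg: "0 \<le> iterate_pow_lim k"
  using iterate_pow_lim by (rule LIMSEQ_le_const) auto

text \<open>The limit over \<open>n\<close> in \<open>norm_pow_aluthge_le_powr\<close> leaves
  \<open>l\<close> on both sides. Cancelling it gives
  \<open>l powr (2 * u) \<le> (p * q) powr u\<close>, and \<open>u > 0\<close> allows the
  root.\<close>

lemma iterate_pow_lim_log_convex: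
  assumes pos: "0 < iterate_pow_lim k" "0 < iterate_pow_lim (Suc k)"
  shows "(iterate_pow_lim (Suc k))\<^sup>2 \<le> iterate_pow_lim k * iterate_pow_lim (Suc (Suc k))"
proof -
  define p l where "p = iterate_pow_lim k" and "l = iterate_pow_lim (Suc k)"
  define u where "u = min t (1 - t)"
  have pl: "0 < p" "0 < l" and u: "0 < u" using pos t by (auto simp: p_def l_def u_def)
  let ?a = "\<lambda>n k. norm (op_pow ((aluthge t ^^ n) T) k)"
  \<comment> \<open>Any \<open>q\<close> above the third limit eventually bounds the norms and is
    positive even if that limit is 0; letting \<open>q\<close> decrease finishes the proof.\<close>
  have main: "l\<^sup>2 \<le> p * q" if q: "iterate_pow_lim (Suc (Suc k)) < q" for q
  proof -
    have q0: "0 < q" using q iterate_pow_lim_nonneg[of "Suc (Suc k)"] by linarith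
    have "\<forall>\<^sub>F n in sequentially. l \<le> ?a n (Suc k) powr (1 - 2 * u) * (?a n k * q) powr u"
      using order_tendstoD(2)[OF iterate_pow_lim q] order_tendstoD(1)[OF iterate_pow_lim pos(1)]
        order_tendstoD(1)[OF iterate_pow_lim pos(2)]
    proof eventually_elim
      case (elim n)
      have "l \<le> ?a (Suc n) (Suc k)" unfolding l_def by (rule iterate_pow_lim_le)
      also have "?a (Suc n) (Suc k) = norm (op_pow (aluthge t ((aluthge t ^^ n) T)) (Suc k))"
        by simp
      also have "\<dots> \<le> ?a n (Suc k) powr (1 - 2 * u) * (?a n k * q) powr u"
        unfolding u_def
        by (rule norm_pow_aluthge_le_powr[OF clinear_aluthge_iterate t elim(2,3) less_imp_le[OF elim(1)] q0])
      finally show ?case .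
    qed
    moreover have "(\<lambda>n. ?a n (Suc k) powr (1 - 2 * u) * (?a n k * q) powr u) \<longlonglongrightarrow> l powr (1 - 2 * u) * (p * q) powr u"
      unfolding p_def l_def
      using pos q0 by (intro tendsto_mult tendsto_powr iterate_pow_lim tendsto_const) auto
    ultimately have "l \<le> l powr (1 - 2 * u) * (p * q) powr u"
      using tendsto_lowerbound trivial_limit_sequentially by blast
    then have "l powr (2 * u) * l \<le> l powr (2 * u) * (l powr (1 - 2 * u) * (p * q) powr u)"
      by (intro mult_left_mono) auto
    also have "\<dots> = l * (p * q) powr u"
      using pl by (simp flip: powr_add mult.assoc)
    finally have "l powr (2 * u) \<le> (p * q) powr u" using pl by (simp add: mult.commute)
    then have "(l\<^sup>2) powr u \<le> (p * q) powr u" using pl by (simp add: powr_powr flip: powr_numeral)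
    then show ?thesis using powr_less_mono2[of u "p * q" "l\<^sup>2"] u pl q0 by force
  qed
  have "l\<^sup>2 / p \<le> iterate_pow_lim (Suc (Suc k))"
  proof (rule dense_ge)
    fix q assume "iterate_pow_lim (Suc (Suc k)) < q"
    from main[OF this] show "l\<^sup>2 / p \<le> q" using pl by (simp add: divide_le_eq mult.commute)
  qed
  then show ?thesis using pl by (simp add: divide_le_eq mult.commute p_def l_def)
qed

lemma power_iterate_lim_le:
  assumes "\<exists>x::'a. x \<noteq> 0"
  shows "iterate_pow_lim 1 ^ k \<le> norm (op_pow T k)"
proof -
  define s where "s = iterate_pow_lim 1"
  have id: "norm (id_blinfun :: 'a \<Rightarrow>\<^sub>L 'a) = 1" using assms norm_id_blinfun_eq_1 by blast
  have L0: "iterate_pow_lim 0 = 1"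
    using LIMSEQ_unique[OF iterate_pow_lim[of 0]] by (simp add: id)
  have "0 \<le> s" unfolding s_def by (rule iterate_pow_lim_nonneg)
  show ?thesis
  proof (cases "s = 0 \<or> k = 0")
    case True
    then show ?thesis unfolding s_def[symmetric] by (cases k) (auto simp: id)
  next
    case False
    with \<open>0 \<le> s\<close> have s: "0 < s" by simp
    \<comment> \<open>The ratios of consecutive limits do not decrease and start at
      \<open>s\<close>. Positivity is carried along because log-convexity presupposes it.\<close>
    have step: "0 < iterate_pow_lim j \<and> s * iterate_pow_lim j \<le> iterate_pow_lim (Suc j)" for j
    proof (induction j)
      case 0
      then show ?case by (simp add: L0 s_def)
    next
      case (Suc j)
      let ?p = "iterate_pow_lim j" and ?l = "iterate_pow_lim (Suc j)" and ?r = "iterate_pow_lim (Suc (Suc j))"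
      have p: "0 < ?p" using Suc by simp
      then have "0 < s * ?p" using s by simp
      then have l: "0 < ?l" using Suc by linarith
      have "(s * ?p) * ?l \<le> ?l * ?l" using Suc l by (intro mult_right_mono) auto
      then have "?p * (s * ?l) \<le> ?l\<^sup>2" by (simp add: power2_eq_square mult_ac)
      also have "\<dots> \<le> ?p * ?r" by (rule iterate_pow_lim_log_convex[OF p l])
      finally show ?case using p l by simp
    qed
    have "s ^ k \<le> iterate_pow_lim k"
    proof (induction k)
      case (Suc k)
      have "s ^ Suc k \<le> s * iterate_pow_lim k" using Suc s by simp
      also have "\<dots> \<le> iterate_pow_lim (Suc k)" using step by simp
      finally show ?case .
    qed (simp add: L0)
    also have "iterate_pow_lim k \<le> norm (op_pow T k)"
      using iterate_pow_lim_le[of "k - 1" 0] False by (cases k) auto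
    finally show ?thesis unfolding s_def .
  qed
qed

text \<open>A nonzero spectral point survives every transform, so the norm of each iterate bounds
  it. The point 0 is covered by nonnegativity of the limit.\<close>

lemma spectrum_norm_le_lim:
  assumes "z \<in> op_spectrum T"
  shows "cmod z \<le> iterate_pow_lim 1"
proof (cases "z = 0")
  case False
  have "z \<in> op_spectrum ((aluthge t ^^ n) T)" for n
  proof (induction n)
    case (Suc n)
    from spectrum_aluthge[OF clinear_aluthge_iterate t this False] show ?case by simp
  qed (simp add: assms)
  then have le: "cmod z \<le> norm ((aluthge t ^^ n) T)" for n by (rule spectrum_norm_le)
  have "(\<lambda>n. norm ((aluthge t ^^ n) T)) \<longlonglongrightarrow> iterate_pow_lim 1" using iterate_pow_lim[of 1] by simp
  then show ?thesis by (rule LIMSEQ_le_const) (intro exI[of _ 0] allI impI le)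
next
  case True
  then show ?thesis using iterate_pow_lim_nonneg[of 1] by simp
qed

end

text \<open>If 0 is outside the spectrum, \<open>T\<close> is invertible and the norms of its powers
  dominate a positive geometric sequence, so \<open>spectrum_lower_bound\<close> produces a point.
  This makes the supremum meaningful also when the limit of the norms is 0.\<close>

lemma spectrum_nonempty:
  fixes T :: "'a::chilbert_space \<Rightarrow>\<^sub>L 'a"
  assumes T: "clinear_op T" and "\<exists>x::'a. x \<noteq> 0"
  shows "op_spectrum T \<noteq> {}"
proof
  assume empty: "op_spectrum T = {}"
  then have "0 \<notin> op_spectrum T" by simp
  then obtain R :: "'a \<Rightarrow>\<^sub>L 'a" where R: "\<And>x. R (T x - 0 *\<^sub>C x) = x"
    "\<And>x. T (R x) - 0 *\<^sub>C R x = x" using not_in_spectrumE by blast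
  define K where "K = norm R + 1"
  have K: "0 < K" by (simp add: K_def add_nonneg_pos)
  have step: "norm x \<le> K * norm (T x)" for x
  proof -
    have "norm x \<le> norm R * norm (T x)" using norm_blinfun[of R "T x"] R(1)[of x] by simp
    also have "\<dots> \<le> K * norm (T x)" by (intro mult_right_mono) (auto simp: K_def)
    finally show ?thesis .
  qed
  have iter: "norm x \<le> K ^ n * norm (op_pow T n x)" for n x
  proof (induction n)
    case (Suc n)
    have "K ^ n * norm (op_pow T n x) \<le> K ^ n * (K * norm (T (op_pow T n x)))"
      by (intro mult_left_mono step) (use K in simp)
    with Suc show ?case by (simp add: mult_ac)
  qed simp
  obtain v :: 'a where v: "v \<noteq> 0" using assms by blast
  have le: "(1 / K) ^ n \<le> norm (op_pow T n)" for n
  proof -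
    have "norm v \<le> K ^ n * (norm (op_pow T n) * norm v)"
      by (rule order_trans[OF iter mult_left_mono[OF norm_blinfun]]) (use K in simp)
    then have "1 \<le> K ^ n * norm (op_pow T n)" using v by (simp flip: mult.assoc)
    then show ?thesis using K by (simp add: power_divide divide_le_eq mult.commute)
  qed
  have "0 < 1 / K / 2" "1 / K / 2 < 1 / K" using K by (simp_all add: field_simps)
  then obtain z where "z \<in> op_spectrum T" by (rule spectrum_lower_bound[OF T _ _ le])
  with empty show False by simp
qed

theorem theorem1p6:
  fixes T :: "'a::chilbert_space \<Rightarrow>\<^sub>L 'a" and t :: real
  assumes "infinite_dimensional TYPE('a)"
    and "clinear_op T"
    and "0 < t" and "t < 1"
  shows "(\<lambda>n. norm ((aluthge t ^^ n) T)) \<longlonglongrightarrow> op_spectral_radius T"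
proof -
  note T = assms(2-4)
  have nonzero: "\<exists>x::'a. x \<noteq> 0" using assms(1) by (rule exists_nonzero_if_infinite_dimensional)
  define s where "s = iterate_pow_lim T t 1"
  have lim: "(\<lambda>n. norm ((aluthge t ^^ n) T)) \<longlonglongrightarrow> s"
    using iterate_pow_lim[OF T, of 1] by (simp add: s_def)
  have pow: "s ^ n \<le> norm (op_pow T n)" for n
    unfolding s_def by (rule power_iterate_lim_le[OF T nonzero])
  have "op_spectral_radius T = s"
    unfolding op_spectral_radius_def
  proof (rule cSup_eq_non_empty)
    show "cmod ` op_spectrum T \<noteq> {}" using spectrum_nonempty[OF assms(2) nonzero] by simp
    show "x \<le> s" if "x \<in> cmod ` op_spectrum T" for x
      using that spectrum_norm_le_lim[OF T] by (auto simp: s_def)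
    fix u assume u: "\<And>x. x \<in> cmod ` op_spectrum T \<Longrightarrow> x \<le> u"
    obtain z where "z \<in> op_spectrum T" using spectrum_nonempty[OF assms(2) nonzero] by auto
    from u[OF imageI[OF this]] have "0 \<le> u" using norm_ge_zero[of z] by linarith
    \<comment> \<open>\<open>spectrum_lower_bound\<close> reaches every positive
      \<open>r < s\<close> but not \<open>s\<close> itself; \<open>0 \<le> u\<close> settles the
      remaining \<open>r\<close>.\<close>
    show "s \<le> u"
    proof (rule dense_le)
      fix r assume r: "r < s"
      show "r \<le> u"
      proof (cases "0 < r")
        case True
        obtain z where "z \<in> op_spectrum T" "r \<le> cmod z"
          by (rule spectrum_lower_bound[OF assms(2) True r pow])
        then show ?thesis using u[of "cmod z"] by simp
      qed (use \<open>0 \<le> u\<close> in simp)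
    qed
  qed
  with lim show ?thesis by simp
qed

end
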